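(* Let $(R,\mathfrak{m},k)$ be a local ring, let $R(k)$ be the trivial extension of $R$ by $k$, and let $M$, $N$ be nonzero, non-free, finitely generated $R(k)$-modules. Then $\mathrm{Tor}_n^{R(k)}(M,N)\neq 0$ for all $n\geq 3$.
   Context: All rings are commutative Noetherian with unity. For an $R$-module $M$, the trivial extension $R(M)$ is the ring whose underlying additive group is $R\oplus M$ with multiplication $(r,m)\cdot(r',m')=(rr',rm'+r'm)$. *)

theory Defs
  imports "HOL-Algebra.Algebra"
begin

definition noetherian_ring :: "('a, 'b) ring_scheme \<Rightarrow> bool" where
  "noetherian_ring R \<longleftrightarrow> cring R \<and>
     (\<forall>I. ideal I R \<longrightarrow> (\<exists>S. finite S \<and> S \<subseteq> carrier R \<and> I = genideal R S))"

definition local_ring :: "('a, 'b) ring_scheme \<Rightarrow> bool" where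
  "local_ring R \<longleftrightarrow> cring R \<and> (\<exists>!m. maximalideal m R)"

definition max_ideal :: "('a, 'b) ring_scheme \<Rightarrow> 'a set" where
  "max_ideal R = (THE m. maximalideal m R)"

definition residue_module :: "('a, 'b) ring_scheme \<Rightarrow> 'a set \<Rightarrow> ('a, 'a set) module" where
  "residue_module R I =
    \<lparr>carrier = carrier (R Quot I), monoid.mult = monoid.mult (R Quot I),
     Group.monoid.one = \<one>\<^bsub>R Quot I\<^esub>, Ring.ring.zero = \<zero>\<^bsub>R Quot I\<^esub>, Ring.ring.add = add (R Quot I),
     smult = (\<lambda>r c. (I +>\<^bsub>R\<^esub> r) \<otimes>\<^bsub>R Quot I\<^esub> c)\<rparr>"

definition triv_ext :: "('a, 'b) ring_scheme \<Rightarrow> ('a, 'c, 'd) module_scheme \<Rightarrow> ('a \<times> 'c) ring" where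
  "triv_ext R M =
    \<lparr>carrier = carrier R \<times> carrier M,
     monoid.mult = (\<lambda>(r, x) (r', x'). (r \<otimes>\<^bsub>R\<^esub> r', (r \<odot>\<^bsub>M\<^esub> x') \<oplus>\<^bsub>M\<^esub> (r' \<odot>\<^bsub>M\<^esub> x))),
     Group.monoid.one = (\<one>\<^bsub>R\<^esub>, \<zero>\<^bsub>M\<^esub>), Ring.ring.zero = (\<zero>\<^bsub>R\<^esub>, \<zero>\<^bsub>M\<^esub>),
     Ring.ring.add = (\<lambda>(r, x) (r', x'). (r \<oplus>\<^bsub>R\<^esub> r', x \<oplus>\<^bsub>M\<^esub> x'))\<rparr>"

definition spans :: "('s, 'x) ring_scheme \<Rightarrow> ('s, 'c, 'e) module_scheme \<Rightarrow> 'c set \<Rightarrow> bool" where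
  "spans S M B \<longleftrightarrow> (\<forall>x\<in>carrier M. \<exists>F c. finite F \<and> F \<subseteq> B \<and> c \<in> F \<rightarrow> carrier S \<and>
      x = (\<Oplus>\<^bsub>M\<^esub>b\<in>F. c b \<odot>\<^bsub>M\<^esub> b))"

definition lin_indep :: "('s, 'x) ring_scheme \<Rightarrow> ('s, 'c, 'e) module_scheme \<Rightarrow> 'c set \<Rightarrow> bool" where
  "lin_indep S M B \<longleftrightarrow> (\<forall>F c. finite F \<longrightarrow> F \<subseteq> B \<longrightarrow> c \<in> F \<rightarrow> carrier S \<longrightarrow>
      (\<Oplus>\<^bsub>M\<^esub>b\<in>F. c b \<odot>\<^bsub>M\<^esub> b) = \<zero>\<^bsub>M\<^esub> \<longrightarrow> (\<forall>b\<in>F. c b = \<zero>\<^bsub>S\<^esub>))"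

definition fin_gen :: "('s, 'x) ring_scheme \<Rightarrow> ('s, 'c, 'e) module_scheme \<Rightarrow> bool" where
  "fin_gen S M \<longleftrightarrow> (\<exists>B. finite B \<and> B \<subseteq> carrier M \<and> spans S M B)"

definition free_module :: "('s, 'x) ring_scheme \<Rightarrow> ('s, 'c, 'e) module_scheme \<Rightarrow> bool" where
  "free_module S M \<longleftrightarrow> (\<exists>B. B \<subseteq> carrier M \<and> spans S M B \<and> lin_indep S M B)"

text \<open>The free module S^b is represented by vectors nat => carrier S supported on {..<b};
  similarly N^b = S^b \<otimes> N by vectors of elements of N.\<close>

definition fvec :: "('s, 'x) ring_scheme \<Rightarrow> nat \<Rightarrow> (nat \<Rightarrow> 's) set" where
  "fvec S b = {v. (\<forall>j<b. v j \<in> carrier S) \<and> (\<forall>j. b \<le> j \<longrightarrow> v j = \<zero>\<^bsub>S\<^esub>)}"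

definition mvec :: "('s, 'c, 'e) module_scheme \<Rightarrow> nat \<Rightarrow> (nat \<Rightarrow> 'c) set" where
  "mvec N b = {v. (\<forall>j<b. v j \<in> carrier N) \<and> (\<forall>j. b \<le> j \<longrightarrow> v j = \<zero>\<^bsub>N\<^esub>)}"

definition mat_app :: "('s, 'x) ring_scheme \<Rightarrow> (nat \<Rightarrow> nat \<Rightarrow> 's) \<Rightarrow> nat \<Rightarrow> nat \<Rightarrow> (nat \<Rightarrow> 's) \<Rightarrow> (nat \<Rightarrow> 's)" where
  "mat_app S A b' b v = (\<lambda>i. if i < b' then (\<Oplus>\<^bsub>S\<^esub>j\<in>{..<b}. A i j \<otimes>\<^bsub>S\<^esub> v j) else \<zero>\<^bsub>S\<^esub>)"

text \<open>The induced map N^b \<rightarrow> N^b' (i.e. A \<otimes> id_N).\<close>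
definition mat_appN :: "('s, 'c, 'e) module_scheme \<Rightarrow> (nat \<Rightarrow> nat \<Rightarrow> 's) \<Rightarrow> nat \<Rightarrow> nat \<Rightarrow> (nat \<Rightarrow> 'c) \<Rightarrow> (nat \<Rightarrow> 'c)" where
  "mat_appN N A b' b x = (\<lambda>i. if i < b' then (\<Oplus>\<^bsub>N\<^esub>j\<in>{..<b}. A i j \<odot>\<^bsub>N\<^esub> x j) else \<zero>\<^bsub>N\<^esub>)"

definition aug :: "('s, 'c, 'e) module_scheme \<Rightarrow> (nat \<Rightarrow> 'c) \<Rightarrow> nat \<Rightarrow> (nat \<Rightarrow> 's) \<Rightarrow> 'c" where
  "aug M e b v = (\<Oplus>\<^bsub>M\<^esub>j\<in>{..<b}. v j \<odot>\<^bsub>M\<^esub> e j)"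

text \<open>A free resolution ... \<rightarrow> S^(b 2) \<rightarrow> S^(b 1) \<rightarrow> S^(b 0) \<rightarrow> M \<rightarrow> 0 of M by finitely
  generated free S-modules; d i is the matrix of the differential S^(b i) \<rightarrow> S^(b (i-1)), i \<ge> 1.\<close>
definition free_resolution ::
  "('s, 'x) ring_scheme \<Rightarrow> ('s, 'c, 'e) module_scheme \<Rightarrow>
   (nat \<Rightarrow> nat) \<times> (nat \<Rightarrow> nat \<Rightarrow> nat \<Rightarrow> 's) \<times> (nat \<Rightarrow> 'c) \<Rightarrow> bool" where
  "free_resolution S M res \<longleftrightarrow> (case res of (b, d, e) \<Rightarrow>
     (\<forall>j<b 0. e j \<in> carrier M) \<and>
     (\<forall>i\<ge>1. \<forall>r<b (i - 1). \<forall>c<b i. d i r c \<in> carrier S) \<and>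
     aug M e (b 0) ` fvec S (b 0) = carrier M \<and>
     {v \<in> fvec S (b 0). aug M e (b 0) v = \<zero>\<^bsub>M\<^esub>} = mat_app S (d 1) (b 0) (b 1) ` fvec S (b 1) \<and>
     (\<forall>i\<ge>1. {v \<in> fvec S (b i). mat_app S (d i) (b (i - 1)) (b i) v = (\<lambda>_. \<zero>\<^bsub>S\<^esub>)}
              = mat_app S (d (Suc i)) (b i) (b (Suc i)) ` fvec S (b (Suc i))))"

definition tor_cycles :: "('s, 'x) ring_scheme \<Rightarrow> ('s, 'c, 'e) module_scheme \<Rightarrow>
    ('s, 'n, 'f) module_scheme \<Rightarrow> nat \<Rightarrow> (nat \<Rightarrow> 'n) set" where
  "tor_cycles S M N n = (case (SOME res. free_resolution S M res) of (b, d, e) \<Rightarrow>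
     (if n = 0 then mvec N (b 0)
      else {x \<in> mvec N (b n). mat_appN N (d n) (b (n - 1)) (b n) x = (\<lambda>_. \<zero>\<^bsub>N\<^esub>)}))"

definition tor_boundaries :: "('s, 'x) ring_scheme \<Rightarrow> ('s, 'c, 'e) module_scheme \<Rightarrow>
    ('s, 'n, 'f) module_scheme \<Rightarrow> nat \<Rightarrow> (nat \<Rightarrow> 'n) set" where
  "tor_boundaries S M N n = (case (SOME res. free_resolution S M res) of (b, d, e) \<Rightarrow>
     mat_appN N (d (Suc n)) (b n) (b (Suc n)) ` mvec N (b (Suc n)))"

text \<open>Tor_n^S(M,N) = cycles / boundaries; it is zero iff every cycle is a boundary.\<close>
definition Tor_zero :: "('s, 'x) ring_scheme \<Rightarrow> ('s, 'c, 'e) module_scheme \<Rightarrow>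
    ('s, 'n, 'f) module_scheme \<Rightarrow> nat \<Rightarrow> bool" where
  "Tor_zero S M N n \<longleftrightarrow> tor_cycles S M N n \<subseteq> tor_boundaries S M N n"

end

theory Submission
  imports Defs
begin

text \<open>
  Let \<open>n\<close> be the maximal ideal of \<open>S = R(k)\<close> and \<open>x = (0, 1)\<close>; then \<open>x n = 0\<close> and \<open>x\<close> lies in \<open>n\<close> but not
  in \<open>n\<^sup>2\<close>. Take any resolution \<open>F\<close> of \<open>M\<close> by finite free modules and put \<open>C\<^sub>i = im d\<^sub>i\<close>. Say that \<open>i\<close> is
  good if some element of \<open>C\<^sub>i \<inter> n F\<^sub>i\<^sub>-\<^sub>1\<close> is not in \<open>n C\<^sub>i\<close>, that is, if \<open>Tor\<^sub>i(M, k)\<close> is nonzero.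
  Since \<open>M\<close> is not free, \<open>1\<close> is good by Nakayama's lemma. If \<open>d\<^sub>i w\<close> witnesses that \<open>i\<close> is good, then
  \<open>x w\<close> witnesses that \<open>i + 1\<close> is good: otherwise a functional \<open>\<psi>\<close> on \<open>F\<^sub>i\<close> with \<open>\<psi>(C\<^sub>i\<^sub>+\<^sub>1) \<subseteq> n\<close> and
  \<open>\<psi>(w)\<close> a unit would give \<open>x \<in> n\<^sup>2\<close>. This witness is moreover killed by \<open>n\<close>.

  So for \<open>i \<ge> 3\<close> there is \<open>w \<in> F\<^sub>i\<^sub>-\<^sub>1\<close> such that \<open>d w\<close> is killed by \<open>n\<close> and is not in \<open>n C\<^sub>i\<^sub>-\<^sub>1\<close>. Let \<open>y\<^sub>j\<close> be
  minimal generators of \<open>N\<close> and \<open>s\<close> a relation between them that is not in \<open>n\<close> times the module of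
  relations. As \<open>s\<^sub>j \<in> n\<close>, one can write \<open>s\<^sub>j w = d z\<^sub>j\<close>. The cycle \<open>\<Sum> z\<^sub>j \<otimes> y\<^sub>j\<close> is not a boundary, because
  otherwise applying \<open>\<psi>\<close> would put \<open>s\<close> into \<open>n\<close> times the module of relations.
\<close>

section \<open>Spans, linear combinations and free modules\<close>

text \<open>For an ideal \<open>A\<close> and a submodule \<open>G\<close>, \<open>lspan M A G\<close> is the submodule \<open>A G\<close>.\<close>
inductive_set lspan :: "('s, 'c, 'e) module_scheme \<Rightarrow> 's set \<Rightarrow> 'c set \<Rightarrow> 'c set"
  for M (structure) and A B where
  lspan_zero: "\<zero> \<in> lspan M A B"
| lspan_step: "\<lbrakk>a \<in> A; b \<in> B; y \<in> lspan M A B\<rbrakk> \<Longrightarrow> a \<odot> b \<oplus> y \<in> lspan M A B"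

text \<open>The vectors \<open>fvec S b\<close> that carry the resolutions are packaged as a module,
  so that syzygies become submodules and matrices become linear maps to which the general lemmas
  apply.\<close>

definition fmod :: "('s, 'x) ring_scheme \<Rightarrow> nat \<Rightarrow> ('s, nat \<Rightarrow> 's) module" where
  "fmod S b = \<lparr>carrier = fvec S b, monoid.mult = undefined, Group.monoid.one = undefined,
     Ring.ring.zero = (\<lambda>_. \<zero>\<^bsub>S\<^esub>), Ring.ring.add = (\<lambda>u v j. u j \<oplus>\<^bsub>S\<^esub> v j),
     smult = (\<lambda>a v j. a \<otimes>\<^bsub>S\<^esub> v j)\<rparr>"

text \<open>The ring as a module over itself: ideals give submodules of it, and
  \<open>aug (smod S) \<psi> b\<close> is the functional on \<open>fmod S b\<close> with entries
  \<open>\<psi> j\<close>.\<close>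

definition smod :: "('s, 'x) ring_scheme \<Rightarrow> ('s, 's) module" where
  "smod S = \<lparr>carrier = carrier S, monoid.mult = monoid.mult S, Group.monoid.one = \<one>\<^bsub>S\<^esub>,
     Ring.ring.zero = \<zero>\<^bsub>S\<^esub>, Ring.ring.add = add S, smult = monoid.mult S\<rparr>"

definition lin :: "('s, 'x) ring_scheme \<Rightarrow> ('s, 'c, 'e) module_scheme \<Rightarrow>
    ('s, 'd, 'f) module_scheme \<Rightarrow> ('c \<Rightarrow> 'd) set" where
  "lin S P Q = {f. f \<in> carrier P \<rightarrow> carrier Q \<and>
     (\<forall>u\<in>carrier P. \<forall>v\<in>carrier P. f (u \<oplus>\<^bsub>P\<^esub> v) = f u \<oplus>\<^bsub>Q\<^esub> f v) \<and>
     (\<forall>a\<in>carrier S. \<forall>u\<in>carrier P. f (a \<odot>\<^bsub>P\<^esub> u) = a \<odot>\<^bsub>Q\<^esub> f u)}"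

text \<open>Stated for a subset \<open>G\<close> of an ambient module, so that syzygies can stay
  inside a free module and need no module structure of their own.\<close>

definition fgen :: "('s, 'x) ring_scheme \<Rightarrow> ('s, 'c, 'e) module_scheme \<Rightarrow> 'c set \<Rightarrow> bool" where
  "fgen S P G \<longleftrightarrow> (\<exists>B. finite B \<and> B \<subseteq> G \<and> G \<subseteq> lspan P (carrier S) B)"

definition noeth :: "('s, 'x) ring_scheme \<Rightarrow> ('s, 'c, 'e) module_scheme \<Rightarrow> bool" where
  "noeth S P \<longleftrightarrow> (\<forall>G. submodule G S P \<longrightarrow> fgen S P G)"

context module
begin

lemma submodule_criterion:
  assumes "H \<subseteq> carrier M" "\<zero>\<^bsub>M\<^esub> \<in> H"
    and "\<And>a b. \<lbrakk>a \<in> H; b \<in> H\<rbrakk> \<Longrightarrow> a \<oplus>\<^bsub>M\<^esub> b \<in> H"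
    and s: "\<And>a x. \<lbrakk>a \<in> carrier R; x \<in> H\<rbrakk> \<Longrightarrow> a \<odot>\<^bsub>M\<^esub> x \<in> H"
  shows "submodule H R M"
proof (rule submoduleI)
  fix a assume "a \<in> H"
  then have "(\<ominus> \<one>) \<odot>\<^bsub>M\<^esub> a \<in> H" using s by simp
  then show "\<ominus>\<^bsub>M\<^esub> a \<in> H"
    using \<open>a \<in> H\<close> assms(1) by (auto simp: smult_l_minus subset_iff)
qed (use assms in auto)

lemma submodule_zero: "submodule H R M \<Longrightarrow> \<zero>\<^bsub>M\<^esub> \<in> H"
  by (metis R.zero_closed equals0I smult_l_null submoduleE(1,2,4) subsetD)

lemma submodule_diff:
  "\<lbrakk>submodule H R M; a \<in> H; b \<in> H\<rbrakk> \<Longrightarrow> a \<ominus>\<^bsub>M\<^esub> b \<in> H"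
  by (simp add: a_minus_def submoduleE(3,5))

lemma lspan_subset_submodule:
  assumes "submodule G R M" "A \<subseteq> carrier R" "B \<subseteq> G"
  shows "lspan M A B \<subseteq> G"
proof
  fix z assume "z \<in> lspan M A B"
  then show "z \<in> G"
  proof induction
    case lspan_zero
    then show ?case using assms submodule_zero by blast
  next
    case (lspan_step a b y)
    then show ?case using assms by (meson submoduleE(4,5) subsetD)
  qed
qed

lemma lspan_closed: "\<lbrakk>A \<subseteq> carrier R; B \<subseteq> carrier M\<rbrakk> \<Longrightarrow> lspan M A B \<subseteq> carrier M"
  by (rule lspan_subset_submodule[OF carrier_is_submodule])

lemma lspan_base:
  assumes "A \<subseteq> carrier R" "B \<subseteq> carrier M" "a \<in> A" "b \<in> B"
  shows "a \<odot>\<^bsub>M\<^esub> b \<in> lspan M A B"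
  using lspan_step[OF assms(3,4) lspan_zero, of M] assms by (auto simp: subset_iff)

lemma lspan_add:
  assumes "A \<subseteq> carrier R" "B \<subseteq> carrier M" "u \<in> lspan M A B" "v \<in> lspan M A B"
  shows "u \<oplus>\<^bsub>M\<^esub> v \<in> lspan M A B"
  using assms(3)
proof induction
  case lspan_zero
  then show ?case using assms lspan_closed by (auto simp: subset_iff)
next
  case (lspan_step a b y)
  have "a \<odot>\<^bsub>M\<^esub> b \<oplus>\<^bsub>M\<^esub> y \<oplus>\<^bsub>M\<^esub> v = a \<odot>\<^bsub>M\<^esub> b \<oplus>\<^bsub>M\<^esub> (y \<oplus>\<^bsub>M\<^esub> v)"
    using lspan_step assms lspan_closed by (intro M.a_assoc) (auto simp: subset_iff)
  then show ?case using lspan_step by (auto intro: lspan.lspan_step)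
qed

lemma lspan_smult:
  assumes "A \<subseteq> carrier R" "B \<subseteq> carrier M" "r \<in> carrier R" "\<And>a. a \<in> A \<Longrightarrow> r \<otimes> a \<in> A"
    and "u \<in> lspan M A B"
  shows "r \<odot>\<^bsub>M\<^esub> u \<in> lspan M A B"
  using assms(5)
proof induction
  case lspan_zero
  then show ?case using assms by (auto intro: lspan.intros)
next
  case (lspan_step a b y)
  have "r \<odot>\<^bsub>M\<^esub> (a \<odot>\<^bsub>M\<^esub> b \<oplus>\<^bsub>M\<^esub> y) = (r \<otimes> a) \<odot>\<^bsub>M\<^esub> b \<oplus>\<^bsub>M\<^esub> r \<odot>\<^bsub>M\<^esub> y"
    using lspan_step assms lspan_closed[of A B] by (auto simp: subset_iff smult_r_distr smult_assoc1)
  then show ?case using lspan_step assms by (auto intro: lspan.lspan_step)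
qed

lemma lspan_submodule:
  assumes "A \<subseteq> carrier R" "B \<subseteq> carrier M" "\<And>r a. r \<in> carrier R \<Longrightarrow> a \<in> A \<Longrightarrow> r \<otimes> a \<in> A"
  shows "submodule (lspan M A B) R M"
  using assms by (intro submodule_criterion lspan_closed lspan_zero lspan_add lspan_smult)

lemma lspan_carrier_submodule: "B \<subseteq> carrier M \<Longrightarrow> submodule (lspan M (carrier R) B) R M"
  by (rule lspan_submodule) auto

lemma lspan_carrier_base: "\<lbrakk>B \<subseteq> carrier M; b \<in> B\<rbrakk> \<Longrightarrow> b \<in> lspan M (carrier R) B"
  using lspan_base[of "carrier R" B \<one> b] by (auto simp: subset_iff)

lemma lspan_mono: "\<lbrakk>A \<subseteq> A'; B \<subseteq> B'\<rbrakk> \<Longrightarrow> lspan M A B \<subseteq> lspan M A' B'"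
proof
  fix z assume "A \<subseteq> A'" "B \<subseteq> B'" "z \<in> lspan M A B"
  from this(3,1,2) show "z \<in> lspan M A' B'" by induction (auto intro: lspan.intros)
qed

lemma lspan_finsum:
  assumes "A \<subseteq> carrier R" "B \<subseteq> carrier M" "finite F" "\<And>j. j \<in> F \<Longrightarrow> a j \<in> A" "\<And>j. j \<in> F \<Longrightarrow> y j \<in> B"
  shows "(\<Oplus>\<^bsub>M\<^esub>j\<in>F. a j \<odot>\<^bsub>M\<^esub> y j) \<in> lspan M A B"
  using assms(3,4,5)
proof induction
  case empty
  then show ?case by (auto intro: lspan.intros)
next
  case (insert j F)
  have "(\<Oplus>\<^bsub>M\<^esub>j\<in>insert j F. a j \<odot>\<^bsub>M\<^esub> y j) = a j \<odot>\<^bsub>M\<^esub> y j \<oplus>\<^bsub>M\<^esub> (\<Oplus>\<^bsub>M\<^esub>j\<in>F. a j \<odot>\<^bsub>M\<^esub> y j)"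
    using insert assms(1,2) by (intro M.finsum_insert) (auto simp: subset_iff)
  then show ?case using insert by (auto intro: lspan.intros)
qed

lemma aug_0: "aug M y 0 a = \<zero>\<^bsub>M\<^esub>"
  by (simp add: aug_def)

lemma aug_Suc:
  assumes "\<And>j. j < Suc p \<Longrightarrow> a j \<in> carrier R" "\<And>j. j < Suc p \<Longrightarrow> y j \<in> carrier M"
  shows "aug M y (Suc p) a = a p \<odot>\<^bsub>M\<^esub> y p \<oplus>\<^bsub>M\<^esub> aug M y p a"
  unfolding aug_def lessThan_Suc using assms by (intro M.finsum_insert) auto

lemma aug_closed:
  assumes "\<And>j. j < p \<Longrightarrow> a j \<in> carrier R" "\<And>j. j < p \<Longrightarrow> y j \<in> carrier M"
  shows "aug M y p a \<in> carrier M"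
  unfolding aug_def using assms by (intro M.finsum_closed) auto

lemma aug_cong:
  assumes "\<And>j. j < p \<Longrightarrow> a j = a' j" "\<And>j. j < p \<Longrightarrow> y j = y' j"
    "\<And>j. j < p \<Longrightarrow> a' j \<in> carrier R" "\<And>j. j < p \<Longrightarrow> y' j \<in> carrier M"
  shows "aug M y p a = aug M y' p a'"
  unfolding aug_def using assms by (intro M.finsum_cong') auto

lemma aug_add:
  assumes "\<And>j. j < p \<Longrightarrow> a j \<in> carrier R" "\<And>j. j < p \<Longrightarrow> a' j \<in> carrier R"
    "\<And>j. j < p \<Longrightarrow> y j \<in> carrier M"
  shows "aug M y p (\<lambda>j. a j \<oplus> a' j) = aug M y p a \<oplus>\<^bsub>M\<^esub> aug M y p a'"
proof -
  have "aug M y p (\<lambda>j. a j \<oplus> a' j) = (\<Oplus>\<^bsub>M\<^esub>j\<in>{..<p}. a j \<odot>\<^bsub>M\<^esub> y j \<oplus>\<^bsub>M\<^esub> a' j \<odot>\<^bsub>M\<^esub> y j)"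
    unfolding aug_def using assms by (intro M.finsum_cong') (auto simp: smult_l_distr)
  also have "\<dots> = aug M y p a \<oplus>\<^bsub>M\<^esub> aug M y p a'"
    unfolding aug_def using assms by (intro M.finsum_addf) auto
  finally show ?thesis .
qed

lemma aug_smult:
  assumes "\<And>j. j < p \<Longrightarrow> a j \<in> carrier R" "r \<in> carrier R" "\<And>j. j < p \<Longrightarrow> y j \<in> carrier M"
  shows "aug M y p (\<lambda>j. r \<otimes> a j) = r \<odot>\<^bsub>M\<^esub> aug M y p a"
proof -
  have "aug M y p (\<lambda>j. r \<otimes> a j) = (\<Oplus>\<^bsub>M\<^esub>j\<in>{..<p}. r \<odot>\<^bsub>M\<^esub> (a j \<odot>\<^bsub>M\<^esub> y j))"
    unfolding aug_def using assms by (intro M.finsum_cong') (auto simp: smult_assoc1)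
  also have "\<dots> = r \<odot>\<^bsub>M\<^esub> aug M y p a"
    unfolding aug_def using assms by (intro finsum_smult_ldistr[symmetric]) auto
  finally show ?thesis .
qed

lemma aug_zero:
  assumes "\<And>j. j < p \<Longrightarrow> y j \<in> carrier M"
  shows "aug M y p (\<lambda>_. \<zero>) = \<zero>\<^bsub>M\<^esub>"
proof -
  have "aug M y p (\<lambda>_. \<zero>) = (\<Oplus>\<^bsub>M\<^esub>j\<in>{..<p}. \<zero>\<^bsub>M\<^esub>)"
    unfolding aug_def using assms by (intro M.finsum_cong') auto
  then show ?thesis by simp
qed

lemma aug_single:
  assumes "\<And>j. j < p \<Longrightarrow> y j \<in> carrier M" "i < p" "r \<in> carrier R"
  shows "aug M y p (\<lambda>j. if j = i then r else \<zero>) = r \<odot>\<^bsub>M\<^esub> y i"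
proof -
  have "aug M y p (\<lambda>j. if j = i then r else \<zero>) =
      (\<Oplus>\<^bsub>M\<^esub>j\<in>{..<p}. if i = j then (r \<odot>\<^bsub>M\<^esub> y j) else \<zero>\<^bsub>M\<^esub>)"
    unfolding aug_def using assms by (intro M.finsum_cong') auto
  then show ?thesis using assms by (simp add: M.finsum_singleton Pi_def)
qed

lemma lspan_aug:
  assumes "A \<subseteq> carrier R" "B \<subseteq> carrier M" "\<And>j. j < p \<Longrightarrow> a j \<in> A" "\<And>j. j < p \<Longrightarrow> y j \<in> B"
  shows "aug M y p a \<in> lspan M A B"
  unfolding aug_def using assms by (intro lspan_finsum) auto

text \<open>Each step of the inductive span is absorbed by adding its scalar to one coefficient, so
  closure of \<open>A\<close> under addition is enough. The cases wanted are the whole ring and the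
  ideal \<open>n\<close>.\<close>

lemma lspan_family:
  assumes "A \<subseteq> carrier R" "\<zero> \<in> A" "\<And>a b. a \<in> A \<Longrightarrow> b \<in> A \<Longrightarrow> a \<oplus> b \<in> A"
    and y: "\<And>j. j < p \<Longrightarrow> y j \<in> carrier M" and z: "z \<in> lspan M A (y ` {..<p})"
  shows "\<exists>a. a \<in> fvec R p \<and> (\<forall>j. a j \<in> A) \<and> z = aug M y p a"
  using z
proof induction
  case lspan_zero
  show ?case using assms by (intro exI[of _ "\<lambda>_. \<zero>"]) (auto simp: fvec_def aug_zero)
next
  case (lspan_step r b z)
  then obtain a i where a: "a \<in> fvec R p" "\<forall>j. a j \<in> A" "z = aug M y p a" and i: "i < p" "b = y i"
    by auto
  have r: "r \<in> A" "r \<in> carrier R" using lspan_step assms(1) by auto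
  let ?a = "\<lambda>j. (if j = i then r else \<zero>) \<oplus> a j"
  have "?a \<in> fvec R p" using a i r by (auto simp: fvec_def)
  moreover have "\<forall>j. ?a j \<in> A" using a assms(2,3) r by auto
  moreover have "r \<odot>\<^bsub>M\<^esub> b \<oplus>\<^bsub>M\<^esub> z = aug M y p ?a"
    using a i r y by (subst aug_add) (auto simp: aug_single fvec_def)
  ultimately show ?case by blast
qed

lemma lspan_carrier_family:
  assumes "\<And>j. j < p \<Longrightarrow> y j \<in> carrier M" "z \<in> lspan M (carrier R) (y ` {..<p})"
  shows "\<exists>a\<in>fvec R p. z = aug M y p a"
  using lspan_family[OF subset_refl _ _ assms] by auto

text \<open>This exchange of summations is what compares coordinates of a free module with
  coefficients of a generating family, both for lifts between covers and for cycles with values in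
  \<open>N\<close>.\<close>

lemma aug_aug:
  assumes "\<And>l. l < b \<Longrightarrow> a l \<in> carrier R" "\<And>j. j < p \<Longrightarrow> y j \<in> carrier M"
    and "\<And>l j. l < b \<Longrightarrow> j < p \<Longrightarrow> B l j \<in> carrier R"
  shows "aug M (\<lambda>l. aug M y p (B l)) b a = aug M y p (\<lambda>j. \<Oplus>l\<in>{..<b}. a l \<otimes> B l j)"
  using assms(1,3)
proof (induction b)
  case 0
  then show ?case using assms(2) by (simp add: aug_0 aug_zero)
next
  case (Suc b)
  have "aug M (\<lambda>l. aug M y p (B l)) (Suc b) a
      = a b \<odot>\<^bsub>M\<^esub> aug M y p (B b) \<oplus>\<^bsub>M\<^esub> aug M (\<lambda>l. aug M y p (B l)) b a"
    using Suc assms(2) by (intro aug_Suc) (auto intro: aug_closed)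
  also have "\<dots> = aug M y p (\<lambda>j. a b \<otimes> B b j) \<oplus>\<^bsub>M\<^esub> aug M y p (\<lambda>j. \<Oplus>l\<in>{..<b}. a l \<otimes> B l j)"
    using Suc assms(2) by (simp add: aug_smult)
  also have "\<dots> = aug M y p (\<lambda>j. a b \<otimes> B b j \<oplus> (\<Oplus>l\<in>{..<b}. a l \<otimes> B l j))"
    using Suc assms(2) by (intro aug_add[symmetric]) (auto intro!: R.finsum_closed)
  also have "\<dots> = aug M y p (\<lambda>j. \<Oplus>l\<in>{..<Suc b}. a l \<otimes> B l j)"
    using Suc assms(2) by (intro aug_cong) (auto simp: lessThan_Suc Pi_def intro!: R.finsum_closed)
  finally show ?case .
qed

end

section \<open>The ring and its finite powers as modules\<close>

context cring
begin

lemma smod_module: "module R (smod R)"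
proof (rule moduleI)
  show "cring R" by (rule is_cring)
  show "abelian_group (smod R)"
    by (rule abelian_groupI) (auto simp: smod_def a_assoc intro: a_comm bexI[of _ "\<ominus> _"] l_neg)
qed (auto simp: smod_def l_distr r_distr m_assoc)

lemma finsum_smod: "finsum (smod R) f A = finsum R f A"
  by (simp add: finsum_def finprod_def smod_def)

lemma aug_smod: "aug (smod R) v b a = (\<Oplus>j\<in>{..<b}. a j \<otimes> v j)"
  by (simp add: aug_def finsum_smod) (simp add: smod_def)

lemma fmod_module: "module R (fmod R b)"
proof (rule moduleI)
  show "cring R" by (rule is_cring)
  show "abelian_group (fmod R b)"
  proof (rule abelian_groupI)
    fix x assume x: "x \<in> carrier (fmod R b)"
    then show "\<exists>y\<in>carrier (fmod R b). y \<oplus>\<^bsub>fmod R b\<^esub> x = \<zero>\<^bsub>fmod R b\<^esub>"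
      by (intro bexI[of _ "\<lambda>j. \<ominus> x j"]) (auto simp: fmod_def fvec_def fun_eq_iff not_less, metis l_neg linorder_not_less minus_zero r_zero zero_closed)
  next
    fix x y z assume *: "x \<in> carrier (fmod R b)" "y \<in> carrier (fmod R b)" "z \<in> carrier (fmod R b)"
    have c: "x j \<in> carrier R" "y j \<in> carrier R" "z j \<in> carrier R" for j
      using * by (cases "j < b"; auto simp: fmod_def fvec_def)+
    show "x \<oplus>\<^bsub>fmod R b\<^esub> y \<oplus>\<^bsub>fmod R b\<^esub> z = x \<oplus>\<^bsub>fmod R b\<^esub> (y \<oplus>\<^bsub>fmod R b\<^esub> z)"
      using c by (auto simp: fmod_def a_assoc)
  next
    fix x y assume *: "x \<in> carrier (fmod R b)" "y \<in> carrier (fmod R b)"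
    have c: "x j \<in> carrier R" "y j \<in> carrier R" for j
      using * by (cases "j < b"; auto simp: fmod_def fvec_def)+
    show "x \<oplus>\<^bsub>fmod R b\<^esub> y = y \<oplus>\<^bsub>fmod R b\<^esub> x"
      using c by (auto simp: fmod_def a_comm)
  next
    fix x assume *: "x \<in> carrier (fmod R b)"
    have c: "x j \<in> carrier R" for j
      using * by (cases "j < b"; auto simp: fmod_def fvec_def)+
    show "\<zero>\<^bsub>fmod R b\<^esub> \<oplus>\<^bsub>fmod R b\<^esub> x = x"
      using c by (auto simp: fmod_def)
  qed (auto simp: fmod_def fvec_def)
next
  fix r s x y assume *: "r \<in> carrier R" "s \<in> carrier R" "x \<in> carrier (fmod R b)" "y \<in> carrier (fmod R b)"
  have c: "x j \<in> carrier R" "y j \<in> carrier R" for j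
    using * by (cases "j < b"; auto simp: fmod_def fvec_def)+
  show "(r \<oplus> s) \<odot>\<^bsub>fmod R b\<^esub> x = r \<odot>\<^bsub>fmod R b\<^esub> x \<oplus>\<^bsub>fmod R b\<^esub> s \<odot>\<^bsub>fmod R b\<^esub> x"
    and "(r \<otimes> s) \<odot>\<^bsub>fmod R b\<^esub> x = r \<odot>\<^bsub>fmod R b\<^esub> (s \<odot>\<^bsub>fmod R b\<^esub> x)"
    and "r \<odot>\<^bsub>fmod R b\<^esub> (x \<oplus>\<^bsub>fmod R b\<^esub> y) = r \<odot>\<^bsub>fmod R b\<^esub> x \<oplus>\<^bsub>fmod R b\<^esub> r \<odot>\<^bsub>fmod R b\<^esub> y"
    using c * by (auto simp: fmod_def l_distr r_distr m_assoc)
next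
  fix x assume *: "x \<in> carrier (fmod R b)"
  have c: "x j \<in> carrier R" for j
    using * by (cases "j < b"; auto simp: fmod_def fvec_def)+
  show "\<one> \<odot>\<^bsub>fmod R b\<^esub> x = x" using c by (auto simp: fmod_def)
qed (auto simp: fmod_def fvec_def)

end

section \<open>Noetherian modules and free resolutions\<close>

locale linear_map = P?: module S P + Q?: module S Q
  for S (structure) and P (structure) and Q (structure) +
  fixes f
  assumes f_lin: "f \<in> lin S P Q"
begin

lemma f_closed [simp, intro]: "u \<in> carrier P \<Longrightarrow> f u \<in> carrier Q"
  using f_lin by (auto simp: lin_def)

lemma f_add: "\<lbrakk>u \<in> carrier P; v \<in> carrier P\<rbrakk> \<Longrightarrow> f (u \<oplus>\<^bsub>P\<^esub> v) = f u \<oplus>\<^bsub>Q\<^esub> f v"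
  using f_lin by (auto simp: lin_def)

lemma f_smult: "\<lbrakk>a \<in> carrier S; u \<in> carrier P\<rbrakk> \<Longrightarrow> f (a \<odot>\<^bsub>P\<^esub> u) = a \<odot>\<^bsub>Q\<^esub> f u"
  using f_lin by (auto simp: lin_def)

lemma f_zero: "f \<zero>\<^bsub>P\<^esub> = \<zero>\<^bsub>Q\<^esub>"
  using f_smult[of "\<zero>" "\<zero>\<^bsub>P\<^esub>"] by simp

lemma f_minus: "\<lbrakk>u \<in> carrier P; v \<in> carrier P\<rbrakk> \<Longrightarrow> f (u \<ominus>\<^bsub>P\<^esub> v) = f u \<ominus>\<^bsub>Q\<^esub> f v"
  using f_add[of u "(\<ominus>\<one>) \<odot>\<^bsub>P\<^esub> v"] f_smult[of "\<ominus>\<one>" v]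
  by (simp add: a_minus_def P.smult_l_minus Q.smult_l_minus)

lemma image_submodule: "submodule G S P \<Longrightarrow> submodule (f ` G) S Q"
proof (rule Q.submodule_criterion)
  assume G: "submodule G S P"
  note GE = P.submoduleE[OF G] P.submodule_zero[OF G]
  show "f ` G \<subseteq> carrier Q" using GE by auto
  show "\<zero>\<^bsub>Q\<^esub> \<in> f ` G" using GE f_zero by (metis image_eqI)
  show "a \<oplus>\<^bsub>Q\<^esub> b \<in> f ` G" if "a \<in> f ` G" "b \<in> f ` G" for a b
    using that GE(1,5) by (force simp: f_add[symmetric] subset_iff)
  show "a \<odot>\<^bsub>Q\<^esub> b \<in> f ` G" if "a \<in> carrier S" "b \<in> f ` G" for a b
    using that GE(1,4) by (force simp: f_smult[symmetric] subset_iff)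
qed

lemma vimage_submodule:
  assumes G: "submodule G S Q" shows "submodule {u \<in> carrier P. f u \<in> G} S P"
  using Q.submoduleE[OF G] Q.submodule_zero[OF G]
  by (intro P.submodule_criterion) (auto simp: f_zero f_add f_smult)

lemma zero_submodule: "submodule {\<zero>\<^bsub>Q\<^esub>} S Q"
  by (rule Q.submodule_criterion) auto

lemma kernel_submodule: "submodule {u \<in> carrier P. f u = \<zero>\<^bsub>Q\<^esub>} S P"
  using vimage_submodule[OF zero_submodule] by simp

text \<open>With \<open>A\<close> the ideal \<open>n\<close>, this carries membership in n times a
  submodule along functionals and differentials, and it also lifts generators of an image.\<close>

lemma image_lspan:
  assumes "A \<subseteq> carrier S" "B \<subseteq> carrier P"
  shows "f ` lspan P A B = lspan Q A (f ` B)"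
proof (intro equalityI subsetI)
  fix z assume "z \<in> f ` lspan P A B"
  then obtain u where u: "u \<in> lspan P A B" and z: "z = f u" by auto
  from u have "f u \<in> lspan Q A (f ` B)"
  proof induction
    case lspan_zero
    then show ?case by (auto simp: f_zero intro: lspan.intros)
  next
    case (lspan_step a b y)
    have "a \<in> carrier S" "b \<in> carrier P" "y \<in> carrier P"
      using lspan_step assms P.lspan_closed[OF assms] by auto
    then have "f (a \<odot>\<^bsub>P\<^esub> b \<oplus>\<^bsub>P\<^esub> y) = a \<odot>\<^bsub>Q\<^esub> f b \<oplus>\<^bsub>Q\<^esub> f y"
      by (simp add: f_add f_smult)
    then show ?case using lspan_step by (auto intro: lspan.intros)
  qed
  then show "z \<in> lspan Q A (f ` B)" using z by simp
next
  fix z assume "z \<in> lspan Q A (f ` B)"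
  then show "z \<in> f ` lspan P A B"
  proof induction
    case lspan_zero
    then show ?case using f_zero by (metis image_eqI lspan.lspan_zero)
  next
    case (lspan_step a b y)
    then obtain b' y' where *: "b = f b'" "b' \<in> B" "y = f y'" "y' \<in> lspan P A B" by auto
    then have "a \<in> carrier S" "b' \<in> carrier P" "y' \<in> carrier P"
      using lspan_step assms P.lspan_closed[OF assms] by auto
    then have "a \<odot>\<^bsub>Q\<^esub> b \<oplus>\<^bsub>Q\<^esub> y = f (a \<odot>\<^bsub>P\<^esub> b' \<oplus>\<^bsub>P\<^esub> y')"
      using * by (simp add: f_add f_smult)
    then show ?case using * lspan_step by (auto intro: lspan.intros)
  qed
qed

end

lemma linear_mapI: "\<lbrakk>module S P; module S Q; f \<in> lin S P Q\<rbrakk> \<Longrightarrow> linear_map S P Q f"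
  by (simp add: linear_map_def linear_map_axioms_def)

text \<open>For exact K, P, Q, a submodule \<open>G\<close> of \<open>P\<close> is generated by
  lifts of generators of its image in \<open>Q\<close> together with the images of generators of its
  preimage in \<open>K\<close>.\<close>

lemma noeth_exact:
  assumes f: "linear_map S P Q f" and g: "linear_map S K P g"
    and ker: "\<And>v. \<lbrakk>v \<in> carrier P; f v = \<zero>\<^bsub>Q\<^esub>\<rbrakk> \<Longrightarrow> v \<in> g ` carrier K"
    and "noeth S K" "noeth S Q"
  shows "noeth S P"
  unfolding noeth_def
proof (intro allI impI)
  interpret f: linear_map S P Q f by fact
  interpret g: linear_map S K P g by fact
  fix G assume G: "submodule G S P"
  note GE = f.P.submoduleE[OF G]
  let ?H = "{u \<in> carrier K. g u \<in> G}"
  have "fgen S Q (f ` G)" "fgen S K ?H"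
    using assms(4,5) f.image_submodule[OF G] g.vimage_submodule[OF G] unfolding noeth_def by blast+
  then obtain B1 B2 where B1: "finite B1" "B1 \<subseteq> f ` G" "f ` G \<subseteq> lspan Q (carrier S) B1"
    and B2: "finite B2" "B2 \<subseteq> ?H" "?H \<subseteq> lspan K (carrier S) B2"
    unfolding fgen_def by blast
  obtain C1 where C1: "C1 \<subseteq> G" "finite C1" "B1 = f ` C1"
    using finite_subset_image[OF B1(1,2)] by blast
  let ?C = "C1 \<union> g ` B2"
  have CG: "?C \<subseteq> G" using C1 B2 by auto
  have CP: "?C \<subseteq> carrier P" using CG GE by blast
  have B2K: "B2 \<subseteq> carrier K" using B2 by auto
  have "z \<in> lspan P (carrier S) ?C" if z: "z \<in> G" for z
  proof -
    have zP: "z \<in> carrier P" using z GE by auto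
    \<comment> \<open>A combination \<open>u\<close> of the lifts has the same image as
      \<open>z\<close>; exactness then brings the difference of \<open>z\<close> and
      \<open>u\<close> back to \<open>K\<close>.\<close>
    have "f z \<in> f ` lspan P (carrier S) C1"
      using f.image_lspan[of "carrier S" C1] B1 C1 CP z by auto
    then obtain u where u: "u \<in> lspan P (carrier S) C1" "f z = f u" by auto
    have uG: "u \<in> G" using f.P.lspan_subset_submodule[OF G] C1 u by blast
    then have uP: "u \<in> carrier P" using GE by auto
    have "z \<ominus>\<^bsub>P\<^esub> u \<in> G" using f.P.submodule_diff[OF G z uG] .
    moreover have "f (z \<ominus>\<^bsub>P\<^esub> u) = \<zero>\<^bsub>Q\<^esub>"
      using zP uP u f.f_minus[OF zP uP] f.Q.M.r_neg[OF f.f_closed[OF uP]] by (simp add: a_minus_def)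
    then obtain w where w: "w \<in> carrier K" "z \<ominus>\<^bsub>P\<^esub> u = g w"
      using ker zP uP by (metis f.P.M.minus_closed imageE)
    ultimately have "w \<in> lspan K (carrier S) B2" using B2 by auto
    then have "g w \<in> lspan P (carrier S) (g ` B2)"
      using g.image_lspan[OF subset_refl B2K] by auto
    then have "g w \<in> lspan P (carrier S) ?C"
      using f.P.lspan_mono[OF subset_refl, of "g ` B2" ?C] by blast
    moreover have "u \<in> lspan P (carrier S) ?C"
      using u f.P.lspan_mono[OF subset_refl, of C1 ?C] by blast
    moreover have "z = g w \<oplus>\<^bsub>P\<^esub> u"
      using w(2) zP uP by (metis a_minus_def f.P.M.a_assoc f.P.M.a_inv_closed f.P.M.l_neg f.P.M.r_zero)
    ultimately show ?thesis using f.P.lspan_add[OF subset_refl CP] by simp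
  qed
  then show "fgen S P G"
    unfolding fgen_def using CG C1 B2 by (intro exI[of _ ?C]) auto
qed

section \<open>Finite free modules, matrices and resolutions\<close>

lemma fvec_carrier: "cring S \<Longrightarrow> v \<in> fvec S b \<Longrightarrow> v j \<in> carrier S"
  by (cases "j < b") (auto simp: fvec_def cring.cring_simprules)

context cring
begin

text \<open>Induction along the projection to the last coordinate. Since vectors are zero beyond
  their length, its kernel is literally \<open>fvec R b\<close>, and the inclusion is the identity
  function.\<close>

lemma noeth_fmod:
  assumes "noeth R (smod R)"
  shows "noeth R (fmod R b)"
proof (induction b)
  case 0
  have "carrier (fmod R 0) = {\<zero>\<^bsub>fmod R 0\<^esub>}" by (auto simp: fmod_def fvec_def)
  then show ?case unfolding noeth_def fgen_def
    using module.submoduleE(1)[OF fmod_module, of _ 0] lspan.lspan_zero[of "fmod R 0"]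
    by (intro allI impI exI[of _ "{}"]) fastforce
next
  case (Suc b)
  show ?case
  proof (rule noeth_exact[OF linear_mapI linear_mapI _ Suc assms])
    show "(\<lambda>v. v b) \<in> lin R (fmod R (Suc b)) (smod R)"
      by (auto simp: lin_def fmod_def smod_def fvec_def)
    show "(\<lambda>v. v) \<in> lin R (fmod R b) (fmod R (Suc b))"
      by (auto simp: lin_def fmod_def fvec_def less_Suc_eq)
    show "v \<in> (\<lambda>v. v) ` carrier (fmod R b)"
      if "v \<in> carrier (fmod R (Suc b))" "v b = \<zero>\<^bsub>smod R\<^esub>" for v
    proof -
      have "v j = \<zero>" if "b \<le> j" for j
        using that \<open>v \<in> carrier (fmod R (Suc b))\<close> \<open>v b = \<zero>\<^bsub>smod R\<^esub>\<close>
        by (cases "j = b") (auto simp: fmod_def fvec_def smod_def)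
      then show ?thesis using that(1) by (auto simp: fmod_def fvec_def)
    qed
  qed (rule fmod_module smod_module)+
qed

lemma aug_fmod:
  assumes "\<And>j. j < p \<Longrightarrow> a j \<in> carrier R" "\<And>j. j < p \<Longrightarrow> y j \<in> fvec R b"
  shows "aug (fmod R b) y p a = (\<lambda>i. \<Oplus>j\<in>{..<p}. a j \<otimes> y j i)"
  using assms
proof (induction p)
  case 0
  show ?case using module.aug_0[OF fmod_module] by (auto simp: fmod_def)
next
  case (Suc p)
  have c: "\<And>j i. j < Suc p \<Longrightarrow> y j i \<in> carrier R" using Suc by (auto intro: fvec_carrier is_cring)
  have "aug (fmod R b) y (Suc p) a = a p \<odot>\<^bsub>fmod R b\<^esub> y p \<oplus>\<^bsub>fmod R b\<^esub> aug (fmod R b) y p a"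
    using Suc by (intro module.aug_Suc[OF fmod_module]) (auto simp: fmod_def)
  also have "\<dots> = (\<lambda>i. \<Oplus>j\<in>{..<Suc p}. a j \<otimes> y j i)"
    using Suc c by (auto simp: fmod_def lessThan_Suc fun_eq_iff Pi_def)
  finally show ?case .
qed

text \<open>A matrix acts by combining its columns. The columns are cut off at \<open>b'\<close>
  because \<open>A\<close> is unconstrained there, whereas elements of \<open>fvec R b'\<close>
  vanish from \<open>b'\<close> on.\<close>

lemma mat_app_eq_aug:
  assumes "\<And>i j. i < b' \<Longrightarrow> j < b \<Longrightarrow> A i j \<in> carrier R" "v \<in> fvec R b"
  shows "mat_app R A b' b v = aug (fmod R b') (\<lambda>j i. if i < b' then A i j else \<zero>) b v"
proof -
  have v: "\<And>j. v j \<in> carrier R" using assms by (auto intro: fvec_carrier is_cring)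
  have "aug (fmod R b') (\<lambda>j i. if i < b' then A i j else \<zero>) b v
      = (\<lambda>i. \<Oplus>j\<in>{..<b}. v j \<otimes> (if i < b' then A i j else \<zero>))"
    using assms v by (intro aug_fmod) (auto simp: fvec_def)
  also have "\<dots> = mat_app R A b' b v"
    unfolding mat_app_def using assms v
    by (auto simp: fun_eq_iff intro!: finsum_cong' m_comm)
  finally show ?thesis by simp
qed

lemma aug_lin:
  assumes M: "module R M" and "\<And>j. j < p \<Longrightarrow> y j \<in> carrier M"
  shows "aug M y p \<in> lin R (fmod R p) M"
proof -
  interpret M: module R M by fact
  have "aug M y p (\<lambda>j. u j \<oplus> v j) = aug M y p u \<oplus>\<^bsub>M\<^esub> aug M y p v"
    if "u \<in> fvec R p" "v \<in> fvec R p" for u v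
    using that assms by (intro M.aug_add) (auto intro: fvec_carrier is_cring)
  moreover have "aug M y p (\<lambda>j. a \<otimes> u j) = a \<odot>\<^bsub>M\<^esub> aug M y p u"
    if "u \<in> fvec R p" "a \<in> carrier R" for u a
    using that assms by (intro M.aug_smult) (auto intro: fvec_carrier is_cring)
  moreover have "aug M y p u \<in> carrier M" if "u \<in> fvec R p" for u
    using that assms by (intro M.aug_closed) (auto intro: fvec_carrier is_cring)
  ultimately show ?thesis by (auto simp: lin_def fmod_def)
qed

lemma aug_linear_map:
  "\<lbrakk>module R M; \<And>j. j < p \<Longrightarrow> y j \<in> carrier M\<rbrakk> \<Longrightarrow> linear_map R (fmod R p) M (aug M y p)"
  using aug_lin fmod_module by (blast intro: linear_mapI)

lemma mat_app_linear_map: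
  assumes "\<And>i j. i < b' \<Longrightarrow> j < b \<Longrightarrow> A i j \<in> carrier R"
  shows "linear_map R (fmod R b) (fmod R b') (mat_app R A b' b)"
proof -
  let ?y = "\<lambda>j i. if i < b' then A i j else \<zero>"
  interpret linear_map R "fmod R b" "fmod R b'" "aug (fmod R b') ?y b"
    using assms by (intro aug_linear_map fmod_module) (auto simp: fmod_def fvec_def)
  have *: "mat_app R A b' b v = aug (fmod R b') ?y b v" if "v \<in> carrier (fmod R b)" for v
    using that assms by (intro mat_app_eq_aug) (auto simp: fmod_def)
  show ?thesis
    by (intro linear_mapI fmod_module) (simp add: lin_def * f_add f_smult Pi_def)
qed

text \<open>Finitely many generators are taken as the columns of \<open>A\<close>. This turns each
  kernel met in a resolution into the image of the next matrix.\<close>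

lemma fgen_fmod_matrix:
  assumes G: "submodule G R (fmod R b)" and "fgen R (fmod R b) G"
  shows "\<exists>l A. (\<forall>i<b. \<forall>j<l. A i j \<in> carrier R) \<and> G = mat_app R A b l ` fvec R l"
proof -
  interpret F: module R "fmod R b" by (rule fmod_module)
  obtain B where B: "finite B" "B \<subseteq> G" "G \<subseteq> lspan (fmod R b) (carrier R) B"
    using assms(2) unfolding fgen_def by blast
  obtain y l where y: "B = y ` {i::nat. i < l}" using finite_imp_nat_seg_image_inj_on[OF B(1)] by auto
  then have y': "B = y ` {..<l}" by auto
  have yG: "\<And>j. j < l \<Longrightarrow> y j \<in> G" using B y by auto
  have yv: "\<And>j. j < l \<Longrightarrow> y j \<in> fvec R b" using yG F.submoduleE(1)[OF G] by (auto simp: fmod_def)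
  have yF: "\<And>j. j < l \<Longrightarrow> y j \<in> carrier (fmod R b)" using yv by (simp add: fmod_def)
  let ?A = "\<lambda>i j. y j i"
  have A: "\<And>i j. j < l \<Longrightarrow> y j i \<in> carrier R" using yv by (auto intro: fvec_carrier is_cring)
  have eq: "mat_app R ?A b l v = aug (fmod R b) y l v" if v: "v \<in> fvec R l" for v
  proof -
    have v': "\<And>j. v j \<in> carrier R" using v by (auto intro: fvec_carrier is_cring)
    have "mat_app R ?A b l v = aug (fmod R b) (\<lambda>j i. if i < b then y j i else \<zero>) l v"
      using v A by (intro mat_app_eq_aug)
    also have "\<dots> = aug (fmod R b) y l v"
      using yv v' by (intro F.aug_cong) (auto simp: fmod_def fvec_def fun_eq_iff)
    finally show ?thesis .
  qed
  have "G = mat_app R ?A b l ` fvec R l"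
  proof (intro equalityI subsetI)
    fix z assume "z \<in> G"
    then have "z \<in> lspan (fmod R b) (carrier R) (y ` {..<l})" using B y' by auto
    then obtain a where "a \<in> fvec R l" "z = aug (fmod R b) y l a"
      using F.lspan_carrier_family[of l y z] yF by blast
    then show "z \<in> mat_app R ?A b l ` fvec R l" using eq by auto
  next
    fix z assume "z \<in> mat_app R ?A b l ` fvec R l"
    then obtain a where a: "a \<in> fvec R l" "z = aug (fmod R b) y l a" using eq by auto
    have "z \<in> lspan (fmod R b) (carrier R) B"
      unfolding a(2)
    proof (rule F.lspan_aug)
      show "B \<subseteq> carrier (fmod R b)" using B F.submoduleE(1)[OF G] by blast
      show "a j \<in> carrier R" for j using a by (auto intro: fvec_carrier is_cring)
      show "y j \<in> B" if "j < l" for j using that y' by blast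
    qed simp
    then show "z \<in> G" using F.lspan_subset_submodule[OF G subset_refl] B by blast
  qed
  with A show ?thesis by (intro exI[of _ l] exI[of _ ?A]) simp
qed

lemma fgen_carrier:
  assumes M: "module R M" and "fin_gen R M"
  shows "fgen R M (carrier M)"
proof -
  interpret M: module R M by fact
  from assms(2) obtain B where B: "finite B" "B \<subseteq> carrier M" and span: "spans R M B"
    unfolding fin_gen_def by (elim exE conjE)
  have "x \<in> lspan M (carrier R) B" if xM: "x \<in> carrier M" for x
  proof -
    from span[unfolded spans_def, rule_format, OF xM] obtain F c
      where F: "finite F" "F \<subseteq> B" "c \<in> F \<rightarrow> carrier R"
      and x: "x = (\<Oplus>\<^bsub>M\<^esub>b\<in>F. c b \<odot>\<^bsub>M\<^esub> b)"
      by (elim exE conjE)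
    have "(\<Oplus>\<^bsub>M\<^esub>b\<in>F. c b \<odot>\<^bsub>M\<^esub> b) \<in> lspan M (carrier R) B"
      using F by (intro M.lspan_finsum[OF subset_refl B(2) F(1)]) auto
    then show ?thesis using x by simp
  qed
  then show ?thesis unfolding fgen_def using B by (intro exI[of _ B] conjI) auto
qed

text \<open>Tor is defined through a resolution picked by \<open>SOME\<close>, so existence is what
  gives the picked triple its properties. Kernels are covered by matrices one after another.\<close>

lemma free_resolution_exists:
  assumes M: "module R M" and fg: "fin_gen R M" and noeth: "noeth R (smod R)"
  shows "\<exists>res. free_resolution R M res"
proof -
  interpret M: module R M by fact
  obtain B where B: "finite B" "B \<subseteq> carrier M" "carrier M \<subseteq> lspan M (carrier R) B"
    using fgen_carrier[OF M fg] unfolding fgen_def by blast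
  obtain e p where "B = e ` {i::nat. i < p}" using finite_imp_nat_seg_image_inj_on[OF B(1)] by auto
  then have e': "B = e ` {..<p}" by auto
  have e: "\<And>j. j < p \<Longrightarrow> e j \<in> carrier M" using B e' by auto
  interpret aug: linear_map R "fmod R p" M "aug M e p" using e by (intro aug_linear_map M)
  have surj: "aug M e p ` fvec R p = carrier M"
  proof (intro equalityI subsetI)
    fix z assume "z \<in> carrier M"
    then have "z \<in> lspan M (carrier R) (e ` {..<p})" using B e' by auto
    then obtain a where "a \<in> fvec R p" "z = aug M e p a"
      using M.lspan_carrier_family[of p e z] e by blast
    then show "z \<in> aug M e p ` fvec R p" by auto
  qed (use aug.f_closed in \<open>auto simp: fmod_def\<close>)
  have matrix: "\<exists>l A. (\<forall>i<b. \<forall>j<l. A i j \<in> carrier R) \<and> G = mat_app R A b l ` fvec R l"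
    if "submodule G R (fmod R b)" for G b
    using noeth_fmod[OF noeth] that fgen_fmod_matrix unfolding noeth_def by blast
  \<comment> \<open>A stage \<open>(m, l, D)\<close> is an m by l matrix. \<open>Ps\<close> makes
    the image of the first matrix the kernel of the augmentation, and \<open>Qs\<close> makes the
    image of each new matrix the kernel of the preceding one.\<close>
  define Ps where "Ps = (\<lambda>(i::nat) (m, l, D). (\<forall>r<m. \<forall>c<l. D r c \<in> carrier R) \<and>
     (i = 0 \<longrightarrow> m = p \<and> {v \<in> fvec R p. aug M e p v = \<zero>\<^bsub>M\<^esub>} = mat_app R D m l ` fvec R l))"
  define Qs where "Qs = (\<lambda>(i::nat) (m, l, D) (m', l', D'). m' = l \<and>
     {v \<in> fvec R l. mat_app R D m l v = (\<lambda>_. \<zero>)} = mat_app R D' m' l' ` fvec R l')"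
  have "\<exists>g. \<forall>i. Ps i (g i) \<and> Qs i (g i) (g (Suc i))"
  proof (rule dependent_nat_choice)
    have "{v \<in> fvec R p. aug M e p v = \<zero>\<^bsub>M\<^esub>} = {v \<in> carrier (fmod R p). aug M e p v = \<zero>\<^bsub>M\<^esub>}"
      by (simp add: fmod_def)
    then show "\<exists>x. Ps 0 x"
      using matrix[OF aug.kernel_submodule] by (auto simp: Ps_def)
  next
    fix x i assume x: "Ps i x"
    obtain m l D where xe: "x = (m, l, D)" by (cases x) auto
    interpret D: linear_map R "fmod R l" "fmod R m" "mat_app R D m l"
      using x xe by (intro mat_app_linear_map) (auto simp: Ps_def)
    have "{v \<in> fvec R l. mat_app R D m l v = (\<lambda>_. \<zero>)} =
        {v \<in> carrier (fmod R l). mat_app R D m l v = \<zero>\<^bsub>fmod R m\<^esub>}"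
      by (simp add: fmod_def)
    then obtain l' D' where "\<forall>i<l. \<forall>j<l'. D' i j \<in> carrier R"
      "{v \<in> fvec R l. mat_app R D m l v = (\<lambda>_. \<zero>)} = mat_app R D' l l' ` fvec R l'"
      using matrix[OF D.kernel_submodule] by metis
    then show "\<exists>y. Ps (Suc i) y \<and> Qs i x y"
      by (intro exI[of _ "(l, l', D')"]) (simp add: Ps_def Qs_def xe)
  qed
  then obtain g where g: "\<And>i. Ps i (g i)" "\<And>i. Qs i (g i) (g (Suc i))" by auto
  define b where "b = (\<lambda>i. fst (g i))"
  \<comment> \<open>Stages are numbered from 0 but differentials from 1, hence the shift. The value
    \<open>d 0\<close> merely repeats \<open>d 1\<close>; the conditions on \<open>d\<close> start
    at 1.\<close>
  define d where "d = (\<lambda>i. snd (snd (g (i - 1))))"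
  have b': "fst (snd (g i)) = b (Suc i)" for i
    using g(2)[of i] by (auto simp: Qs_def b_def split: prod.splits)
  have gi: "g i = (b i, b (Suc i), d (Suc i))" for i
    using b'[of i] by (simp add: b_def d_def prod_eq_iff)
  have b0: "b 0 = p" using g(1)[of 0] by (simp add: gi Ps_def)
  have "free_resolution R M (b, d, e)"
    unfolding free_resolution_def prod.case
  proof (intro conjI allI impI)
    show "e j \<in> carrier M" if "j < b 0" for j using that e b0 by simp
    show "d i r c \<in> carrier R" if "1 \<le> i" "r < b (i - 1)" "c < b i" for i r c
      using g(1)[of "i - 1"] that by (simp add: gi Ps_def)
    show "aug M e (b 0) ` fvec R (b 0) = carrier M" using surj b0 by simp
    show "{v \<in> fvec R (b 0). aug M e (b 0) v = \<zero>\<^bsub>M\<^esub>} = mat_app R (d 1) (b 0) (b 1) ` fvec R (b 1)"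
      using g(1)[of 0] b0 by (simp add: gi Ps_def)
    show "{v \<in> fvec R (b i). mat_app R (d i) (b (i - 1)) (b i) v = (\<lambda>_. \<zero>)}
        = mat_app R (d (Suc i)) (b i) (b (Suc i)) ` fvec R (b (Suc i))" if "1 \<le> i" for i
      using g(2)[of "i - 1"] that by (simp add: gi Qs_def)
  qed
  then show ?thesis ..
qed

end

section \<open>Minimal generators and Nakayama's lemma\<close>

lemma (in cring) fvec_add: "\<lbrakk>u \<in> fvec R b; v \<in> fvec R b\<rbrakk> \<Longrightarrow> (\<lambda>j. u j \<oplus> v j) \<in> fvec R b"
  by (auto simp: fvec_def)

lemma (in cring) fvec_smult: "\<lbrakk>a \<in> carrier R; v \<in> fvec R b\<rbrakk> \<Longrightarrow> (\<lambda>j. a \<otimes> v j) \<in> fvec R b"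
  by (auto simp: fvec_def)

text \<open>When \<open>y\<close> generates \<open>M\<close>, this is the first syzygy of
  \<open>M\<close> for the cover given by \<open>y\<close>.\<close>

definition rel :: "('s, 'x) ring_scheme \<Rightarrow> ('s, 'c, 'e) module_scheme \<Rightarrow> (nat \<Rightarrow> 'c) \<Rightarrow> nat \<Rightarrow> (nat \<Rightarrow> 's) set" where
  "rel S M y p = {s \<in> fvec S p. aug M y p s = \<zero>\<^bsub>M\<^esub>}"

text \<open>A local ring is presented by a proper ideal whose complement consists of units. This is
  the form used when a coefficient outside \<open>n\<close> is inverted, and it can be checked
  directly for R(k).\<close>

locale local_cring = cring +
  fixes n
  assumes n_ideal: "ideal n R" and one_notin_n: "\<one> \<notin> n"
    and unit: "\<lbrakk>a \<in> carrier R; a \<notin> n\<rbrakk> \<Longrightarrow> a \<in> Units R"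
begin

sublocale n: ideal n R by (rule n_ideal)

lemma n_carrier: "n \<subseteq> carrier R" using n.Icarr by auto

lemma lspan_n_submodule: "\<lbrakk>module R M; B \<subseteq> carrier M\<rbrakk> \<Longrightarrow> submodule (lspan M n B) R M"
  using n_carrier n.I_l_closed by (intro module.lspan_submodule) auto

text \<open>Take a generating set of least cardinality. A relation with a unit as its
  \<open>i\<close>-th coefficient could be solved for \<open>y i\<close>, so the other elements
  would still generate; as \<open>y\<close> is injective, they form a strictly smaller set.\<close>

lemma minimal_generators:
  assumes M: "module R M" and G: "submodule G R M" and fg: "fgen R M G"
  obtains p y where "\<forall>j<p. y j \<in> G" "inj_on y {..<p}"
    "G = lspan M (carrier R) (y ` {..<p})" "\<forall>t\<in>rel R M y p. \<forall>j. t j \<in> n"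
proof -
  interpret M: module R M by fact
  let ?gen = "\<lambda>B. finite B \<and> B \<subseteq> G \<and> G \<subseteq> lspan M (carrier R) B"
  obtain B where B: "?gen B" and min: "\<And>C. ?gen C \<Longrightarrow> card B \<le> card C"
    using ex_has_least_nat[of ?gen _ card] fg unfolding fgen_def by metis
  have BM: "B \<subseteq> carrier M" using B M.submoduleE(1)[OF G] by blast
  obtain y where y: "bij_betw y {..<card B} B"
    using ex_bij_betw_nat_finite[of B] B by (auto simp: atLeast0LessThan)
  then have yB: "y ` {..<card B} = B" and inj: "inj_on y {..<card B}" by (auto simp: bij_betw_def)
  have GB: "G = lspan M (carrier R) B"
    using B M.lspan_subset_submodule[OF G subset_refl, of B] by blast
  have min_rel: "a i \<in> n" if a: "\<And>j. j < card B \<Longrightarrow> a j \<in> carrier R"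
    and rel: "aug M y (card B) a = \<zero>\<^bsub>M\<^esub>" and i: "i < card B" for a i
  proof (rule ccontr)
    assume "a i \<notin> n"
    then have u: "a i \<in> Units R" using unit a i by auto
    let ?C = "B - {y i}" and ?r = "\<Oplus>\<^bsub>M\<^esub>j\<in>{..<card B} - {i}. a j \<odot>\<^bsub>M\<^esub> y j"
    let ?L = "lspan M (carrier R) ?C"
    have yM: "\<And>j. j < card B \<Longrightarrow> y j \<in> carrier M" using yB BM by auto
    have L: "submodule ?L R M" using BM by (intro M.lspan_carrier_submodule) auto
    have r: "?r \<in> ?L"
      using BM a yB i inj by (intro M.lspan_finsum) (auto simp: inj_on_def)
    then have rM: "?r \<in> carrier M" using M.submoduleE(1)[OF L] by blast
    have "aug M y (card B) a = (\<Oplus>\<^bsub>M\<^esub>j\<in>insert i ({..<card B} - {i}). a j \<odot>\<^bsub>M\<^esub> y j)"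
      unfolding aug_def using i by (simp add: insert_absorb)
    also have "\<dots> = a i \<odot>\<^bsub>M\<^esub> y i \<oplus>\<^bsub>M\<^esub> ?r"
      using a yM i by (intro M.finsum_insert) auto
    finally have "a i \<odot>\<^bsub>M\<^esub> y i = \<ominus>\<^bsub>M\<^esub> ?r"
      using rel rM a yM i by (simp add: M.M.minus_equality)
    then have "a i \<odot>\<^bsub>M\<^esub> y i \<in> ?L" using r M.submoduleE(3)[OF L] by simp
    then have "inv a i \<odot>\<^bsub>M\<^esub> (a i \<odot>\<^bsub>M\<^esub> y i) \<in> ?L"
      using M.submoduleE(4)[OF L] u by simp
    then have yi: "y i \<in> ?L"
      using u a i yM by (simp add: M.smult_assoc1[symmetric])
    have "B \<subseteq> ?L"
    proof
      fix z assume "z \<in> B"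
      then show "z \<in> ?L" using yi M.lspan_carrier_base[of ?C z] BM by (cases "z = y i") auto
    qed
    then have "G \<subseteq> ?L" using GB M.lspan_subset_submodule[OF L subset_refl] by blast
    then have "?gen ?C" using B by auto
    then have "card B \<le> card ?C" by (rule min)
    moreover have "card ?C < card B" using B yB i by (intro card_Diff1_less) auto
    ultimately show False by simp
  qed
  show thesis
  proof (rule that[of "card B" y])
    show "\<forall>j<card B. y j \<in> G" using yB B by auto
    show "G = lspan M (carrier R) (y ` {..<card B})" using GB yB by simp
    show "\<forall>t\<in>rel R M y (card B). \<forall>j. t j \<in> n"
    proof (intro ballI allI)
      fix t j assume t: "t \<in> rel R M y (card B)"
      show "t j \<in> n"
      proof (cases "j < card B")
        case True
        then show ?thesis using t by (intro min_rel[of t]) (auto simp: rel_def fvec_def)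
      qed (use t in \<open>auto simp: rel_def fvec_def\<close>)
    qed
  qed (fact inj)
qed

end

lemma (in module) lspan_subset_submoduleI:
  assumes L: "submodule L R M" and "\<And>a b. \<lbrakk>a \<in> A; b \<in> B\<rbrakk> \<Longrightarrow> a \<odot>\<^bsub>M\<^esub> b \<in> L"
  shows "lspan M A B \<subseteq> L"
proof
  fix z assume "z \<in> lspan M A B"
  then show "z \<in> L"
  proof induction
    case lspan_zero
    then show ?case using submodule_zero[OF L] by simp
  next
    case (lspan_step a b y)
    then show ?case using assms(2) submoduleE(5)[OF L] by simp
  qed
qed

context cring
begin

lemma rel_submodule:
  assumes M: "module R M" and y: "\<And>j. j < p \<Longrightarrow> y j \<in> carrier M"
  shows "submodule (rel R M y p) R (fmod R p)"
proof -
  interpret linear_map R "fmod R p" M "aug M y p" using y by (intro aug_linear_map M)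
  show ?thesis using kernel_submodule by (simp add: rel_def fmod_def)
qed

text \<open>A basis in the sense of \<open>free_module\<close> is a set, with sums over finite
  subsets. Injectivity of \<open>y\<close> allows such sums to be reindexed as combinations of the
  family.\<close>

lemma free_moduleI:
  assumes M: "module R M" and y: "\<And>j. j < p \<Longrightarrow> y j \<in> carrier M" and inj: "inj_on y {..<p}"
    and gen: "carrier M = lspan M (carrier R) (y ` {..<p})" and rel: "rel R M y p = {\<lambda>_. \<zero>}"
  shows "free_module R M"
proof -
  interpret M: module R M by fact
  let ?B = "y ` {..<p}"
  have "spans R M ?B"
    unfolding spans_def
  proof
    fix x assume "x \<in> carrier M"
    then obtain a where a: "a \<in> fvec R p" "x = aug M y p a"
      using M.lspan_carrier_family[of p y x] y gen by blast
    define c where "c = (\<lambda>b. a (inv_into {..<p} y b))"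
    have c: "c (y j) = a j" if "j < p" for j using that inj by (simp add: c_def)
    have aR: "\<And>j. a j \<in> carrier R" using a by (auto intro: fvec_carrier is_cring)
    have "(\<Oplus>\<^bsub>M\<^esub>b\<in>?B. c b \<odot>\<^bsub>M\<^esub> b) = (\<Oplus>\<^bsub>M\<^esub>j\<in>{..<p}. c (y j) \<odot>\<^bsub>M\<^esub> y j)"
      using inj y c aR by (intro M.M.finsum_reindex) auto
    also have "\<dots> = x"
      unfolding a(2) aug_def using c y aR by (intro M.M.finsum_cong') auto
    finally show "\<exists>F c. finite F \<and> F \<subseteq> ?B \<and> c \<in> F \<rightarrow> carrier R \<and> x = (\<Oplus>\<^bsub>M\<^esub>b\<in>F. c b \<odot>\<^bsub>M\<^esub> b)"
      using c aR by (intro exI[of _ ?B] exI[of _ c]) auto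
  qed
  moreover have "lin_indep R M ?B"
    unfolding lin_indep_def
  proof (intro allI impI ballI)
    fix F c b assume F: "finite F" "F \<subseteq> ?B" "c \<in> F \<rightarrow> carrier R"
      and sum: "(\<Oplus>\<^bsub>M\<^esub>b\<in>F. c b \<odot>\<^bsub>M\<^esub> b) = \<zero>\<^bsub>M\<^esub>" and b: "b \<in> F"
    \<comment> \<open>Extending the coefficients by zero outside \<open>F\<close> turns a dependence
      on \<open>F\<close> into a relation of the whole family, which must be trivial.\<close>
    let ?c = "\<lambda>b. if b \<in> F then c b else \<zero>" and ?a = "\<lambda>j. if j < p \<and> y j \<in> F then c (y j) else \<zero>"
    have cR: "\<And>b. ?c b \<in> carrier R" using F by auto
    have yB: "?B \<subseteq> carrier M" using y by auto
    have "aug M y p ?a = (\<Oplus>\<^bsub>M\<^esub>j\<in>{..<p}. ?c (y j) \<odot>\<^bsub>M\<^esub> y j)"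
      unfolding aug_def using y F by (intro M.M.finsum_cong') (auto simp: Pi_iff)
    also have "\<dots> = (\<Oplus>\<^bsub>M\<^esub>b\<in>?B. ?c b \<odot>\<^bsub>M\<^esub> b)"
      using inj y cR by (intro M.M.finsum_reindex[symmetric]) auto
    also have "\<dots> = (\<Oplus>\<^bsub>M\<^esub>b\<in>F. c b \<odot>\<^bsub>M\<^esub> b)"
      using F cR yB
      by (intro M.M.add.finprod_mono_neutral_cong_left[symmetric]) (auto simp: Pi_iff subset_iff)
    finally have "?a \<in> rel R M y p" using sum F by (auto simp: rel_def fvec_def)
    then have a0: "?a = (\<lambda>_. \<zero>)" using rel by simp
    obtain j where j: "j < p" "b = y j" using b F by auto
    show "c b = \<zero>" using fun_cong[OF a0, of j] j b by simp
  qed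
  ultimately show ?thesis unfolding free_module_def using y by (intro exI[of _ ?B]) auto
qed

end

context local_cring
begin

text \<open>The elements that every scalar in \<open>n\<close> sends into \<open>lspan M n B\<close>
  form a submodule. It contains \<open>B\<close>, hence everything that \<open>B\<close>
  spans.\<close>

lemma lspan_n_lspan:
  assumes M: "module R M" and B: "B \<subseteq> carrier M"
  shows "lspan M n (lspan M (carrier R) B) \<subseteq> lspan M n B"
proof -
  interpret M: module R M by fact
  let ?L = "lspan M n B"
  have L: "submodule ?L R M" by (rule lspan_n_submodule[OF M B])
  have "submodule {g \<in> carrier M. \<forall>a\<in>n. a \<odot>\<^bsub>M\<^esub> g \<in> ?L} R M"
  proof (rule M.submodule_criterion, goal_cases)
    case 1
    show ?case by blast
  next
    case 2
    have "a \<odot>\<^bsub>M\<^esub> \<zero>\<^bsub>M\<^esub> \<in> ?L" if "a \<in> n" for a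
      using that n_carrier M.submodule_zero[OF L] by (auto simp: subset_iff)
    then show ?case by simp
  next
    case (3 g h)
    have "a \<odot>\<^bsub>M\<^esub> (g \<oplus>\<^bsub>M\<^esub> h) \<in> ?L" if "a \<in> n" for a
      using 3 that M.submoduleE(5)[OF L] by (simp add: M.smult_r_distr n.Icarr)
    with 3 show ?case by simp
  next
    case (4 r g)
    have "a \<odot>\<^bsub>M\<^esub> (r \<odot>\<^bsub>M\<^esub> g) \<in> ?L" if "a \<in> n" for a
      using 4 that by (simp add: M.smult_assoc1[symmetric] n.Icarr n.I_r_closed)
    with 4 show ?case by simp
  qed
  moreover have "B \<subseteq> {g \<in> carrier M. \<forall>a\<in>n. a \<odot>\<^bsub>M\<^esub> g \<in> ?L}"
    using B M.lspan_base[OF n_carrier B] by auto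
  ultimately have "lspan M (carrier R) B \<subseteq> {g \<in> carrier M. \<forall>a\<in>n. a \<odot>\<^bsub>M\<^esub> g \<in> ?L}"
    by (intro M.lspan_subset_submodule) auto
  then show ?thesis by (intro M.lspan_subset_submoduleI[OF L]) auto
qed

text \<open>If a minimal generating family were nonempty, its first member would be a combination of
  the family with coefficients in \<open>n\<close>. The resulting relation would have a coefficient
  outside \<open>n\<close>.\<close>

lemma nakayama:
  assumes M: "module R M" and G: "submodule G R M" and fg: "fgen R M G" and nG: "G \<subseteq> lspan M n G"
  shows "G = {\<zero>\<^bsub>M\<^esub>}"
proof -
  interpret M: module R M by fact
  obtain p y where y: "\<forall>j<p. y j \<in> G" "inj_on y {..<p}"
    "G = lspan M (carrier R) (y ` {..<p})" and rel: "\<forall>t\<in>rel R M y p. \<forall>j. t j \<in> n"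
    by (rule minimal_generators[OF M G fg])
  have yM: "y j \<in> carrier M" if "j < p" for j using y(1) that M.submoduleE(1)[OF G] by blast
  have p: "p = 0"
  proof (rule ccontr)
    assume "p \<noteq> 0"
    then have p0: "0 < p" by simp
    have "y 0 \<in> lspan M n (lspan M (carrier R) (y ` {..<p}))"
      using y(1) p0 nG unfolding y(3)[symmetric] by blast
    then have "y 0 \<in> lspan M n (y ` {..<p})"
      using lspan_n_lspan[OF M, of "y ` {..<p}"] yM by blast
    then have "\<exists>a. a \<in> fvec R p \<and> (\<forall>j. a j \<in> n) \<and> y 0 = aug M y p a"
      using n_carrier yM by (intro M.lspan_family) auto
    then obtain a where a: "a \<in> fvec R p" "\<forall>j. a j \<in> n" "y 0 = aug M y p a"
      by blast
    have aR: "\<And>j. a j \<in> carrier R" using a(2) n.Icarr by blast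
    \<comment> \<open>Subtracting \<open>y 0\<close> from its expression gives a relation with
      coefficient a(0) - 1 at place 0. Minimality puts it in \<open>n\<close>; as a(0) is in
      \<open>n\<close> too, so is 1.\<close>
    let ?a = "\<lambda>j. (if j = 0 then \<ominus> \<one> else \<zero>) \<oplus> a j"
    have "aug M y p ?a = aug M y p (\<lambda>j. if j = 0 then \<ominus> \<one> else \<zero>) \<oplus>\<^bsub>M\<^esub> aug M y p a"
      using aR yM by (intro M.aug_add) auto
    also have "\<dots> = (\<ominus> \<one>) \<odot>\<^bsub>M\<^esub> y 0 \<oplus>\<^bsub>M\<^esub> y 0"
      using a(3) p0 yM by (subst M.aug_single) auto
    also have "\<dots> = \<zero>\<^bsub>M\<^esub>"
      using yM[OF p0] by (simp add: M.smult_l_minus M.M.l_neg)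
    finally have "?a \<in> rel R M y p" using a(1) p0 by (auto simp: rel_def fvec_def)
    then have "?a 0 \<in> n" using rel by fast
    then have "a 0 \<ominus> (\<ominus> \<one> \<oplus> a 0) \<in> n" using a(2) by (simp add: a_minus_def)
    moreover have "a 0 \<ominus> (\<ominus> \<one> \<oplus> a 0) = \<one>"
      using aR[of 0] by (simp add: a_minus_def minus_add a_ac r_neg)
    ultimately show False using one_notin_n by simp
  qed
  have "lspan M (carrier R) {} \<subseteq> {\<zero>\<^bsub>M\<^esub>}"
    by (rule M.lspan_subset_submodule) (auto intro: M.submodule_criterion)
  then show ?thesis using y(3) p M.submodule_zero[OF G] by auto
qed

text \<open>Without relations, minimal generators would form a basis. So the relation module is
  nonzero, and it is finitely generated because the ring is Noetherian; by Nakayama it exceeds n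
  times itself.\<close>

lemma non_free_relation:
  assumes M: "module R M" and fg: "fin_gen R M" and nonfree: "\<not> free_module R M"
    and noeth: "noeth R (smod R)"
  obtains p y s where "\<forall>j<p. y j \<in> carrier M" "carrier M \<subseteq> aug M y p ` fvec R p"
    "\<forall>t\<in>rel R M y p. \<forall>j. t j \<in> n"
    "s \<in> rel R M y p" "s \<notin> lspan (fmod R p) n (rel R M y p)"
proof -
  interpret M: module R M by fact
  obtain p y where y0: "\<forall>j<p. y j \<in> carrier M" and y: "inj_on y {..<p}"
    "carrier M = lspan M (carrier R) (y ` {..<p})" and rel: "\<forall>t\<in>rel R M y p. \<forall>j. t j \<in> n"
    by (rule minimal_generators[OF M M.carrier_is_submodule fgen_carrier[OF M fg]])
  have yM: "\<And>j. j < p \<Longrightarrow> y j \<in> carrier M" using y0 by simp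
  have sub: "submodule (rel R M y p) R (fmod R p)" by (rule rel_submodule[OF M yM])
  have "rel R M y p \<noteq> {\<lambda>_. \<zero>}"
    using free_moduleI[OF M yM y] nonfree by blast
  moreover have "fgen R (fmod R p) (rel R M y p)"
    using noeth_fmod[OF noeth] sub unfolding noeth_def by blast
  ultimately have "\<not> rel R M y p \<subseteq> lspan (fmod R p) n (rel R M y p)"
    using nakayama[OF fmod_module sub] by (auto simp: fmod_def)
  then obtain s where s: "s \<in> rel R M y p" "s \<notin> lspan (fmod R p) n (rel R M y p)" by blast
  have "carrier M \<subseteq> aug M y p ` fvec R p"
  proof
    fix z assume "z \<in> carrier M"
    then show "z \<in> aug M y p ` fvec R p"
      using M.lspan_carrier_family[of p y z] yM y(2) by blast
  qed
  then show thesis using that y0 rel s by meson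
qed

end

section \<open>Separating functionals\<close>

lemma linear_map_id: "module S P \<Longrightarrow> linear_map S P P (\<lambda>u. u)"
  by (intro linear_mapI) (auto simp: lin_def)

lemma linear_map_comp:
  assumes "linear_map S P Q f" "linear_map S Q T g"
  shows "linear_map S P T (\<lambda>u. g (f u))"
proof -
  interpret f: linear_map S P Q f by fact
  interpret g: linear_map S Q T g by fact
  show ?thesis
    by (intro linear_mapI f.P.module_axioms g.Q.module_axioms)
      (auto simp: lin_def f.f_add f.f_smult g.f_add g.f_smult)
qed

lemma linear_map_diff:
  assumes "linear_map S P Q f" "linear_map S P Q g"
  shows "linear_map S P Q (\<lambda>u. f u \<ominus>\<^bsub>Q\<^esub> g u)"
proof -
  interpret f: linear_map S P Q f by fact
  interpret g: linear_map S P Q g by fact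
  have "(a \<oplus>\<^bsub>Q\<^esub> b) \<ominus>\<^bsub>Q\<^esub> (c \<oplus>\<^bsub>Q\<^esub> d) = (a \<ominus>\<^bsub>Q\<^esub> c) \<oplus>\<^bsub>Q\<^esub> (b \<ominus>\<^bsub>Q\<^esub> d)"
    if "a \<in> carrier Q" "b \<in> carrier Q" "c \<in> carrier Q" "d \<in> carrier Q" for a b c d
    using that by (simp add: a_minus_def f.Q.M.minus_add f.Q.M.a_ac)
  moreover have "r \<odot>\<^bsub>Q\<^esub> a \<ominus>\<^bsub>Q\<^esub> r \<odot>\<^bsub>Q\<^esub> b = r \<odot>\<^bsub>Q\<^esub> (a \<ominus>\<^bsub>Q\<^esub> b)"
    if "a \<in> carrier Q" "b \<in> carrier Q" "r \<in> carrier S" for a b r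
    using that by (simp add: a_minus_def f.Q.smult_r_distr f.Q.smult_r_minus)
  ultimately show ?thesis
    by (intro linear_mapI f.P.module_axioms f.Q.module_axioms)
      (simp add: lin_def Pi_def f.f_add f.f_smult g.f_add g.f_smult)
qed

lemma linear_map_scale:
  assumes d: "linear_map S P (smod S) d" and Q: "module S Q" and w: "w \<in> carrier Q"
  shows "linear_map S P Q (\<lambda>u. d u \<odot>\<^bsub>Q\<^esub> w)"
proof -
  interpret d: linear_map S P "smod S" d by fact
  interpret Q: module S Q by fact
  have dS: "d u \<in> carrier S" if "u \<in> carrier P" for u using d.f_closed[OF that] by (simp add: smod_def)
  have add: "d (u \<oplus>\<^bsub>P\<^esub> v) = d u \<oplus>\<^bsub>S\<^esub> d v" if "u \<in> carrier P" "v \<in> carrier P" for u v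
    using d.f_add[OF that] by (simp add: smod_def)
  have smult: "d (a \<odot>\<^bsub>P\<^esub> u) = a \<otimes>\<^bsub>S\<^esub> d u" if "a \<in> carrier S" "u \<in> carrier P" for a u
    using d.f_smult[OF that] by (simp add: smod_def)
  show ?thesis
    by (intro linear_mapI d.P.module_axioms Q)
      (simp add: lin_def Pi_def add smult dS w Q.smult_l_distr Q.smult_assoc1)
qed

context cring
begin

lemma fmod_minus:
  assumes "u \<in> fvec R b" "v \<in> fvec R b"
  shows "u \<ominus>\<^bsub>fmod R b\<^esub> v = (\<lambda>j. u j \<ominus> v j)"
proof -
  interpret F: module R "fmod R b" by (rule fmod_module)
  have "v \<in> carrier (fmod R b)" using assms by (simp add: fmod_def)
  then have "\<ominus>\<^bsub>fmod R b\<^esub> v = (\<ominus> \<one>) \<odot>\<^bsub>fmod R b\<^esub> v" by (simp add: F.smult_l_minus)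
  also have "\<dots> = (\<lambda>j. \<ominus> v j)"
    using fvec_carrier[OF is_cring assms(2)] by (simp add: fmod_def l_minus)
  finally have *: "\<ominus>\<^bsub>fmod R b\<^esub> v = (\<lambda>j. \<ominus> v j)" .
  show ?thesis unfolding a_minus_def * by (simp add: fmod_def)
qed

definition unit_vec :: "nat \<Rightarrow> nat \<Rightarrow> 'a" where
  "unit_vec j = (\<lambda>i. if i = j then \<one> else \<zero>)"

lemma unit_vec_fvec: "j < b \<Longrightarrow> unit_vec j \<in> fvec R b"
  by (auto simp: unit_vec_def fvec_def)

lemma aug_unit_vec:
  assumes v: "v \<in> fvec R b"
  shows "aug (fmod R b) unit_vec b v = v"
proof -
  have vR: "\<And>j. v j \<in> carrier R" using v by (auto intro: fvec_carrier is_cring)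
  have "aug (fmod R b) unit_vec b v = (\<lambda>i. \<Oplus>j\<in>{..<b}. v j \<otimes> unit_vec j i)"
    using vR by (intro aug_fmod unit_vec_fvec)
  also have "\<dots> = v"
  proof
    fix i
    have "(\<Oplus>j\<in>{..<b}. v j \<otimes> unit_vec j i) = (\<Oplus>j\<in>{..<b}. if i = j then v j else \<zero>)"
      using vR by (intro finsum_cong') (auto simp: unit_vec_def)
    also have "\<dots> = v i"
    proof (cases "i < b")
      case True
      then show ?thesis using vR by (intro finsum_singleton) auto
    next
      case False
      then have "(\<Oplus>j\<in>{..<b}. if i = j then v j else \<zero>) = (\<Oplus>j\<in>{..<b}. \<zero>)"
        by (intro finsum_cong') auto
      then show ?thesis using v False by (simp add: fvec_def)
    qed
    finally show "(\<Oplus>j\<in>{..<b}. v j \<otimes> unit_vec j i) = v i" .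
  qed
  finally show ?thesis .
qed

lemma aug_comp:
  assumes M: "module R M" and t: "t \<in> fvec R p"
    and B: "\<And>j. j < p \<Longrightarrow> B j \<in> fvec R b" and e: "\<And>i. i < b \<Longrightarrow> e i \<in> carrier M"
  shows "aug M e b (aug (fmod R b) B p t) = aug M (\<lambda>j. aug M e b (B j)) p t"
proof -
  interpret M: module R M by fact
  have "aug (fmod R b) B p t = (\<lambda>i. \<Oplus>j\<in>{..<p}. t j \<otimes> B j i)"
    using t B by (intro aug_fmod) (auto intro: fvec_carrier is_cring)
  then show ?thesis
    using t B e by (subst M.aug_aug) (auto intro: fvec_carrier is_cring)
qed

end

context local_cring
begin

lemma n_finsum:
  assumes "finite F" "\<And>j. j \<in> F \<Longrightarrow> a j \<in> n"
  shows "(\<Oplus>j\<in>F. a j) \<in> n"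
  using assms
proof (induction F)
  case (insert j F)
  then have "(\<Oplus>j\<in>insert j F. a j) = a j \<oplus> (\<Oplus>j\<in>F. a j)"
    by (intro finsum_insert) (auto intro: n.Icarr)
  then show ?case using insert by simp
qed simp

lemma n_fvec_lspan:
  assumes v: "v \<in> fvec R b" "\<And>j. v j \<in> n"
  shows "v \<in> lspan (fmod R b) n (fvec R b)"
proof -
  interpret F: module R "fmod R b" by (rule fmod_module)
  have "aug (fmod R b) unit_vec b v \<in> lspan (fmod R b) n (fvec R b)"
    using n_carrier v unit_vec_fvec by (intro F.lspan_aug) (auto simp: fmod_def)
  then show ?thesis using aug_unit_vec v by simp
qed

text \<open>Let F be \<open>fmod R b\<close>. By \<open>notin\<close>, \<open>w\<close> lies outside
  G + nF, so in the vector space F/nF over the residue field its class lies outside the image of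
  \<open>G\<close>. A linear form that separates the two lifts to F; the argument is carried out in
  F itself, without the quotient.\<close>

lemma separating_functional:
  assumes G: "submodule G R (fmod R b)" and w: "w \<in> fvec R b"
    and notin: "\<And>g. g \<in> G \<Longrightarrow> \<exists>j. w j \<ominus> g j \<notin> n"
  shows "\<exists>\<psi>. (\<forall>j<b. \<psi> j \<in> carrier R) \<and> (\<forall>g\<in>G. aug (smod R) \<psi> b g \<in> n) \<and> aug (smod R) \<psi> b w \<notin> n"
proof -
  interpret F: module R "fmod R b" by (rule fmod_module)
  have wR: "w j \<in> carrier R" for j using w by (rule fvec_carrier[OF is_cring])
  have GF: "G \<subseteq> fvec R b" using F.submoduleE(1)[OF G] by (simp add: fmod_def)
  have gR: "g j \<in> carrier R" if "g \<in> G" for g j using GF that by (auto intro: fvec_carrier is_cring)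
  \<comment> \<open>For \<open>J\<close> within the index range, \<open>H J\<close> is the sum of
    \<open>G\<close>, nF and the span of the unit vectors with index in \<open>J\<close>, expressed
    by coordinates.\<close>
  define H where "H = (\<lambda>J. {v \<in> fvec R b. \<exists>g\<in>G. \<forall>j. j \<notin> J \<longrightarrow> v j \<ominus> g j \<in> n})"
  have diff: "(u \<oplus> v) \<ominus> (g \<oplus> h) = (u \<ominus> g) \<oplus> (v \<ominus> h)"
    if "u \<in> carrier R" "v \<in> carrier R" "g \<in> carrier R" "h \<in> carrier R" for u v g h
    using that by (simp add: a_minus_def minus_add a_ac)
  have H: "submodule (H J) R (fmod R b)" for J
  proof (rule F.submodule_criterion, goal_cases)
    case 1
    show ?case by (auto simp: H_def fmod_def)
  next
    case 2
    show ?case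
      using F.submodule_zero[OF G]
      by (auto simp: H_def fmod_def fvec_def a_minus_def intro!: bexI[of _ "\<lambda>_. \<zero>"])
  next
    case (3 u v)
    then obtain g h where *: "g \<in> G" "h \<in> G" "\<forall>j. j \<notin> J \<longrightarrow> u j \<ominus> g j \<in> n"
      "\<forall>j. j \<notin> J \<longrightarrow> v j \<ominus> h j \<in> n" "u \<in> fvec R b" "v \<in> fvec R b" by (auto simp: H_def)
    have "(\<lambda>j. g j \<oplus> h j) \<in> G" using F.submoduleE(5)[OF G *(1,2)] by (simp add: fmod_def)
    moreover have "\<forall>j. j \<notin> J \<longrightarrow> (u j \<oplus> v j) \<ominus> (g j \<oplus> h j) \<in> n"
      using * gR fvec_carrier[OF is_cring *(5)] fvec_carrier[OF is_cring *(6)] by (simp add: diff)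
    ultimately show ?case
      using fvec_add[OF *(5,6)] by (auto simp: H_def fmod_def)
  next
    case (4 a v)
    then obtain g where *: "g \<in> G" "\<forall>j. j \<notin> J \<longrightarrow> v j \<ominus> g j \<in> n" "v \<in> fvec R b" by (auto simp: H_def)
    have vR: "v j \<in> carrier R" for j using *(3) by (rule fvec_carrier[OF is_cring])
    have "(\<lambda>j. a \<otimes> g j) \<in> G" using F.submoduleE(4)[OF G 4(1) *(1)] by (simp add: fmod_def)
    moreover have "a \<otimes> v j \<ominus> a \<otimes> g j = a \<otimes> (v j \<ominus> g j)" for j
      using 4(1) gR[OF *(1)] vR by (simp add: a_minus_def r_distr r_minus)
    then have "\<forall>j. j \<notin> J \<longrightarrow> a \<otimes> v j \<ominus> a \<otimes> g j \<in> n"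
      using *(2) 4(1) by (simp add: n.I_l_closed)
    ultimately show ?case
      using fvec_smult[OF 4(1) *(3)] by (auto simp: H_def fmod_def)
  qed
  have GH: "G \<subseteq> H J" for J
  proof
    fix g assume "g \<in> G"
    then show "g \<in> H J" using GF gR[of g]
      by (auto simp: H_def a_minus_def r_neg intro!: bexI[of _ g])
  qed
  \<comment> \<open>For a maximal \<open>J\<close> with \<open>w \<notin> H J\<close>, every basis vector is congruent to a multiple of \<open>w\<close>
    modulo \<open>H J\<close>; these multiples are the entries of \<open>\<psi>\<close>.\<close>
  let ?P = "\<lambda>J. J \<subseteq> {..<b} \<and> w \<notin> H J"
  have "?P {}" using notin by (auto simp: H_def)
  moreover have "\<forall>J. ?P J \<longrightarrow> card J \<le> b" using card_mono[of "{..<b}"] by fastforce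
  ultimately have "\<exists>J. ?P J \<and> (\<forall>J'. ?P J' \<longrightarrow> card J' \<le> card J)"
    using ex_has_greatest_nat[of ?P "{}" card "Suc b"] by (simp add: less_Suc_eq_le)
  then obtain J where J: "?P J" and max: "\<forall>J'. ?P J' \<longrightarrow> card J' \<le> card J"
    by (elim exE conjE) (rule that, blast+)
  have wF: "w \<in> carrier (fmod R b)" using w by (simp add: fmod_def)
  have wJ: "w \<notin> H J" using J by simp
  have coord: "\<exists>c\<in>carrier R. unit_vec i \<ominus>\<^bsub>fmod R b\<^esub> c \<odot>\<^bsub>fmod R b\<^esub> w \<in> H J" if i: "i < b" for i
  proof (cases "i \<in> J")
    case True
    have "unit_vec i \<in> H J"
      using F.submodule_zero[OF G] i True unit_vec_fvec[OF i]
      by (auto simp: H_def fmod_def unit_vec_def a_minus_def intro!: bexI[of _ "\<lambda>_. \<zero>"])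
    then have "unit_vec i \<ominus>\<^bsub>fmod R b\<^esub> \<zero> \<odot>\<^bsub>fmod R b\<^esub> w \<in> H J"
      using F.submodule_diff[OF H _ F.submodule_zero[OF H]] wF by simp
    then show ?thesis by blast
  next
    case False
    then have "card J < card (insert i J)"
      using J finite_subset[of J "{..<b}"] by auto
    then have "w \<in> H (insert i J)" using max[rule_format, of "insert i J"] J i by auto
    then obtain g where g: "g \<in> G" "\<And>j. j \<notin> insert i J \<Longrightarrow> w j \<ominus> g j \<in> n" by (auto simp: H_def)
    define a where "a = w i \<ominus> g i"
    have aR: "a \<in> carrier R" using wR gR[OF g(1)] by (simp add: a_def)
    have "a \<notin> n"
    proof
      assume "a \<in> n"
      then have "w j \<ominus> g j \<in> n" if "j \<notin> J" for j
        using g(2)[of j] that by (cases "j = i") (auto simp: a_def)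
      then show False using wJ w g(1) by (auto simp: H_def)
    qed
    then have u: "a \<in> Units R" using unit aR by simp
    \<comment> \<open>Subtracting \<open>a\<close> times the unit vector at \<open>i\<close> from
      \<open>w\<close> makes the \<open>i\<close>-th coordinate equal to \<open>g i\<close>, so the
      result lies in \<open>H J\<close>. Scaling by minus the inverse of \<open>a\<close> gives the
      wanted congruence for the unit vector.\<close>
    let ?v = "\<lambda>j. w j \<ominus> a \<otimes> unit_vec i j"
    have vF: "?v \<in> fvec R b" using w unit_vec_fvec[OF i] aR by (auto simp: fvec_def a_minus_def)
    have "?v j \<ominus> g j \<in> n" if "j \<notin> J" for j
    proof (cases "j = i")
      case True
      have "?v i \<ominus> g i = w i \<ominus> g i \<ominus> a"
        using wR gR[OF g(1)] aR by (simp add: unit_vec_def a_minus_def a_ac)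
      also have "\<dots> = \<zero>"
        unfolding a_def[symmetric] using aR by (simp add: a_minus_def r_neg)
      finally show ?thesis using True by simp
    next
      case False
      then show ?thesis using g(2) wR aR that by (simp add: unit_vec_def a_minus_def)
    qed
    then have v: "?v \<in> H J" using vF g(1) by (auto simp: H_def)
    let ?c = "inv a"
    have cR: "?c \<in> carrier R" using u by simp
    have "(\<ominus> ?c) \<odot>\<^bsub>fmod R b\<^esub> ?v \<in> H J" using F.submoduleE(4)[OF H _ v] cR by simp
    moreover have "(\<ominus> ?c) \<odot>\<^bsub>fmod R b\<^esub> ?v = unit_vec i \<ominus>\<^bsub>fmod R b\<^esub> ?c \<odot>\<^bsub>fmod R b\<^esub> w"
    proof -
      have "\<ominus> ?c \<otimes> (w j \<ominus> a \<otimes> e) = e \<ominus> ?c \<otimes> w j" if "e \<in> carrier R" for e j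
        using that cR aR wR[of j] u
        by (simp add: a_minus_def r_distr l_minus r_minus m_assoc[symmetric] a_comm)
      then show ?thesis
        using fmod_minus[OF unit_vec_fvec[OF i] fvec_smult[OF cR w]]
        by (simp add: fmod_def unit_vec_def)
    qed
    ultimately show ?thesis using cR by auto
  qed
  then obtain \<psi> where \<psi>: "\<And>i. i < b \<Longrightarrow> \<psi> i \<in> carrier R"
    "\<And>i. i < b \<Longrightarrow> unit_vec i \<ominus>\<^bsub>fmod R b\<^esub> \<psi> i \<odot>\<^bsub>fmod R b\<^esub> w \<in> H J"
    by metis
  interpret d: linear_map R "fmod R b" "smod R" "aug (smod R) \<psi> b"
    using \<psi> by (intro aug_linear_map smod_module) (auto simp: smod_def)
  let ?d = "aug (smod R) \<psi> b"
  \<comment> \<open>Each unit vector is sent into \<open>H J\<close>, hence so is every vector: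
    modulo \<open>H J\<close>, every \<open>v\<close> is \<psi>(v) times \<open>w\<close>.\<close>
  define h where "h = (\<lambda>v. v \<ominus>\<^bsub>fmod R b\<^esub> ?d v \<odot>\<^bsub>fmod R b\<^esub> w)"
  interpret h: linear_map R "fmod R b" "fmod R b" h
    unfolding h_def
    by (intro linear_map_diff linear_map_id linear_map_scale fmod_module d.linear_map_axioms wF)
  have dR: "?d v \<in> carrier R" if "v \<in> fvec R b" for v
    using d.f_closed[of v] that by (simp add: fmod_def smod_def)
  have d_unit: "?d (unit_vec i) = \<psi> i" if "i < b" for i
    using module.aug_single[OF smod_module, of b \<psi> i \<one>] \<psi>(1) that
    by (simp add: unit_vec_def smod_def)
  have hH: "h v \<in> H J" if v: "v \<in> fvec R b" for v
  proof -
    have "submodule {v \<in> carrier (fmod R b). h v \<in> H J} R (fmod R b)" by (rule h.vimage_submodule[OF H])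
    moreover have "unit_vec i \<in> {v \<in> carrier (fmod R b). h v \<in> H J}" if "i < b" for i
      using that \<psi>(2) unit_vec_fvec[OF that] by (simp add: h_def d_unit fmod_def)
    then have "unit_vec ` {..<b} \<subseteq> {v \<in> carrier (fmod R b). h v \<in> H J}" by auto
    ultimately have "lspan (fmod R b) (carrier R) (unit_vec ` {..<b}) \<subseteq> {v \<in> carrier (fmod R b). h v \<in> H J}"
      by (intro F.lspan_subset_submodule) auto
    moreover have "aug (fmod R b) unit_vec b v \<in> lspan (fmod R b) (carrier R) (unit_vec ` {..<b})"
      using unit_vec_fvec v by (intro F.lspan_aug) (auto simp: fmod_def intro: fvec_carrier is_cring)
    ultimately show ?thesis using aug_unit_vec[OF v] by auto
  qed
  \<comment> \<open>A unit multiple of \<open>w\<close> cannot lie in \<open>H J\<close>. Applied to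
    \<psi>(g) for \<open>g\<close> in \<open>G\<close>, this gives the vanishing modulo
    \<open>n\<close>; applied to 1 - \<psi>(w), it shows that \<psi>(w) is outside
    \<open>n\<close>.\<close>
  have in_n: "c \<in> n" if c: "c \<in> carrier R" "c \<odot>\<^bsub>fmod R b\<^esub> w \<in> H J" for c
  proof (rule ccontr)
    assume "c \<notin> n"
    then have u: "c \<in> Units R" using unit c by simp
    then have "inv c \<odot>\<^bsub>fmod R b\<^esub> (c \<odot>\<^bsub>fmod R b\<^esub> w) \<in> H J" using F.submoduleE(4)[OF H _ c(2)] by simp
    then show False using u c(1) wF wJ by (simp add: F.smult_assoc1[symmetric])
  qed
  have "?d g \<in> n" if g: "g \<in> G" for g
  proof (rule in_n)
    have gF: "g \<in> fvec R b" using g GF by auto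
    show "?d g \<in> carrier R" using dR gF by simp
    have "g \<ominus>\<^bsub>fmod R b\<^esub> h g \<in> H J"
      using F.submodule_diff[OF H] GH hH[OF gF] g by blast
    moreover have "g \<ominus>\<^bsub>fmod R b\<^esub> h g = ?d g \<odot>\<^bsub>fmod R b\<^esub> w"
    proof -
      have *: "?d g \<odot>\<^bsub>fmod R b\<^esub> w \<in> carrier (fmod R b)" "g \<in> carrier (fmod R b)"
        using dR[OF gF] wF gF F.smult_closed by (simp_all add: fmod_def)
      then show ?thesis
        by (simp add: h_def a_minus_def F.M.minus_add F.M.a_assoc[symmetric] F.M.r_neg)
    qed
    ultimately show "?d g \<odot>\<^bsub>fmod R b\<^esub> w \<in> H J" by simp
  qed
  moreover have "?d w \<notin> n"
  proof
    assume dn: "?d w \<in> n"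
    have "h w = (\<one> \<ominus> ?d w) \<odot>\<^bsub>fmod R b\<^esub> w"
      using dR[OF w] wF by (simp add: h_def a_minus_def F.smult_l_distr F.smult_l_minus)
    then have "\<one> \<ominus> ?d w \<in> n" using hH[OF w] dR[OF w] by (intro in_n) auto
    then have "(\<one> \<ominus> ?d w) \<oplus> ?d w \<in> n" using dn by simp
    then show False using one_notin_n dR[OF w] by (simp add: a_minus_def a_assoc l_neg)
  qed
  ultimately show ?thesis using \<psi>(1) by blast
qed

end

section \<open>Socle elements in syzygies\<close>

lemma (in linear_map) f_aug:
  assumes a: "\<And>j. j < p \<Longrightarrow> a j \<in> carrier S" and y: "\<And>j. j < p \<Longrightarrow> y j \<in> carrier P"
  shows "f (aug P y p a) = aug Q (\<lambda>j. f (y j)) p a"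
  using assms
proof (induction p)
  case 0
  show ?case by (simp add: P.aug_0 Q.aug_0 f_zero)
next
  case (Suc p)
  have "aug P y p a \<in> carrier P" using Suc.prems by (intro P.aug_closed) auto
  moreover have "aug P y (Suc p) a = a p \<odot>\<^bsub>P\<^esub> y p \<oplus>\<^bsub>P\<^esub> aug P y p a"
    using Suc.prems by (rule P.aug_Suc)
  moreover have "aug Q (\<lambda>j. f (y j)) (Suc p) a = a p \<odot>\<^bsub>Q\<^esub> f (y p) \<oplus>\<^bsub>Q\<^esub> aug Q (\<lambda>j. f (y j)) p a"
    using Suc.prems by (intro Q.aug_Suc) auto
  ultimately show ?case using Suc by (simp add: f_add f_smult)
qed

context local_cring
begin

text \<open>The functional separates \<open>w\<close> from the kernel of the matrix map D. If
  \<open>w\<close> were congruent modulo \<open>n\<close> to some \<open>g\<close> in the kernel,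
  then D(w) = D(w - g) would lie in n times the image of D, against \<open>notin\<close>.\<close>

lemma matrix_functional:
  assumes A: "\<And>i j. i < b' \<Longrightarrow> j < b \<Longrightarrow> A i j \<in> carrier R" and w: "w \<in> fvec R b"
    and notin: "mat_app R A b' b w \<notin> lspan (fmod R b') n (mat_app R A b' b ` fvec R b)"
  shows "\<exists>\<psi>. (\<forall>j<b. \<psi> j \<in> carrier R) \<and>
    (\<forall>g\<in>fvec R b. mat_app R A b' b g = (\<lambda>_. \<zero>) \<longrightarrow> aug (smod R) \<psi> b g \<in> n) \<and>
    aug (smod R) \<psi> b w \<notin> n"
proof -
  let ?D = "mat_app R A b' b"
  interpret D: linear_map R "fmod R b" "fmod R b'" ?D by (rule mat_app_linear_map[OF A])
  let ?G = "{u \<in> carrier (fmod R b). ?D u = \<zero>\<^bsub>fmod R b'\<^esub>}"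
  have "\<exists>j. w j \<ominus> g j \<notin> n" if g: "g \<in> ?G" for g
  proof (rule ccontr)
    assume "\<nexists>j. w j \<ominus> g j \<notin> n"
    then have n: "\<And>j. w j \<ominus> g j \<in> n" by blast
    have gF: "g \<in> fvec R b" using g by (simp add: fmod_def)
    have wF: "w \<in> carrier (fmod R b)" "g \<in> carrier (fmod R b)" using w gF by (simp_all add: fmod_def)
    have eq: "w \<ominus>\<^bsub>fmod R b\<^esub> g = (\<lambda>j. w j \<ominus> g j)" by (rule fmod_minus[OF w gF])
    have "w \<ominus>\<^bsub>fmod R b\<^esub> g \<in> fvec R b" using D.P.M.minus_closed[OF wF] by (simp add: fmod_def)
    then have "w \<ominus>\<^bsub>fmod R b\<^esub> g \<in> lspan (fmod R b) n (fvec R b)"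
      using n by (intro n_fvec_lspan) (auto simp: eq)
    then have "?D (w \<ominus>\<^bsub>fmod R b\<^esub> g) \<in> lspan (fmod R b') n (?D ` fvec R b)"
      using D.image_lspan[OF n_carrier, of "fvec R b"] by (auto simp: fmod_def)
    moreover have "?D (w \<ominus>\<^bsub>fmod R b\<^esub> g) = ?D w"
      using D.f_minus[OF wF] g D.f_closed[OF wF(1)] D.Q.submodule_zero[OF D.Q.carrier_is_submodule]
      by (simp add: a_minus_def)
    ultimately show False using notin by simp
  qed
  from separating_functional[OF D.kernel_submodule w this] show ?thesis
    by (auto simp: fmod_def)
qed

text \<open>This is the start of the induction on good indices. The cover \<open>e\<close> belongs
  to an arbitrary resolution and may fail to be minimal, so the relation \<open>s\<close> found for
  minimal generators is transported to it. Its entries stay in \<open>n\<close>, and mapping back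
  shows that it stays outside n times the syzygies.\<close>

lemma syzygy_notin_n_syzygies:
  assumes M: "module R M" and fg: "fin_gen R M" and nonfree: "\<not> free_module R M"
    and noeth: "noeth R (smod R)"
    and e: "\<And>j. j < b \<Longrightarrow> e j \<in> carrier M" and surj: "aug M e b ` fvec R b = carrier M"
  shows "\<exists>c\<in>rel R M e b. (\<forall>j. c j \<in> n) \<and> c \<notin> lspan (fmod R b) n (rel R M e b)"
proof -
  interpret M: module R M by fact
  obtain p y s where y0: "\<forall>j<p. y j \<in> carrier M" and gen: "carrier M \<subseteq> aug M y p ` fvec R p"
    and rel_n: "\<forall>t\<in>rel R M y p. \<forall>j. t j \<in> n"
    and s: "s \<in> rel R M y p" and s_notin: "s \<notin> lspan (fmod R p) n (rel R M y p)"
    by (rule non_free_relation[OF M fg nonfree noeth])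
  have y: "\<And>j. j < p \<Longrightarrow> y j \<in> carrier M" using y0 by simp
  have "\<forall>i\<in>{..<b}. \<exists>a\<in>fvec R p. e i = aug M y p a" using gen e by blast
  then obtain \<alpha> where \<alpha>: "\<And>i. i < b \<Longrightarrow> \<alpha> i \<in> fvec R p" "\<And>i. i < b \<Longrightarrow> e i = aug M y p (\<alpha> i)"
    by (metis lessThan_iff)
  have "\<forall>j\<in>{..<p}. \<exists>a\<in>fvec R b. y j = aug M e b a" using surj y by blast
  then obtain \<beta> where \<beta>: "\<And>j. j < p \<Longrightarrow> \<beta> j \<in> fvec R b" "\<And>j. j < p \<Longrightarrow> y j = aug M e b (\<beta> j)"
    by (metis lessThan_iff)
  \<comment> \<open>\<open>?f\<close> and \<open>?g\<close> compare the given cover of \<open>M\<close> with the minimal one: both commute with the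
    augmentations, so \<open>?f \<circ> ?g\<close> is the identity up to relations.\<close>
  let ?f = "aug (fmod R p) \<alpha> b" and ?g = "aug (fmod R b) \<beta> p"
  interpret f: linear_map R "fmod R b" "fmod R p" ?f
    using \<alpha> by (intro aug_linear_map fmod_module) (simp add: fmod_def)
  interpret g: linear_map R "fmod R p" "fmod R b" ?g
    using \<beta> by (intro aug_linear_map fmod_module) (simp add: fmod_def)
  have f_eq: "aug M y p (?f t) = aug M e b t" if "t \<in> fvec R b" for t
  proof -
    have tR: "\<And>i. t i \<in> carrier R" using that by (auto intro: fvec_carrier is_cring)
    have "aug M y p (?f t) = aug M (\<lambda>i. aug M y p (\<alpha> i)) b t"
      using that \<alpha>(1) y by (intro aug_comp[OF M])
    also have "\<dots> = aug M e b t"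
      using \<alpha>(2) e tR by (intro M.aug_cong) simp_all
    finally show ?thesis .
  qed
  have g_eq: "aug M e b (?g t) = aug M y p t" if "t \<in> fvec R p" for t
  proof -
    have tR: "\<And>i. t i \<in> carrier R" using that by (auto intro: fvec_carrier is_cring)
    have "aug M e b (?g t) = aug M (\<lambda>i. aug M e b (\<beta> i)) p t"
      using that \<beta>(1) e by (intro aug_comp[OF M])
    also have "\<dots> = aug M y p t"
      using \<beta>(2) y tR by (intro M.aug_cong) simp_all
    finally show ?thesis .
  qed
  have f_fvec: "?f t \<in> fvec R p" if "t \<in> fvec R b" for t
    using f.f_closed[of t] that by (simp add: fmod_def)
  have g_fvec: "?g t \<in> fvec R b" if "t \<in> fvec R p" for t
    using g.f_closed[of t] that by (simp add: fmod_def)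
  let ?h = "\<lambda>t. t \<ominus>\<^bsub>fmod R p\<^esub> ?f (?g t)"
  interpret h: linear_map R "fmod R p" "fmod R p" ?h
    by (intro linear_map_diff linear_map_id fmod_module linear_map_comp[OF g.linear_map_axioms f.linear_map_axioms])
  interpret a: linear_map R "fmod R p" M "aug M y p" by (rule aug_linear_map[OF M y])
  have h_rel: "?h t \<in> rel R M y p" if t: "t \<in> fvec R p" for t
  proof -
    have c: "t \<in> carrier (fmod R p)" "?f (?g t) \<in> carrier (fmod R p)"
      using t f_fvec g_fvec by (simp_all add: fmod_def)
    have "aug M y p (?h t) = aug M y p t \<ominus>\<^bsub>M\<^esub> aug M y p t"
      using a.f_minus[OF c] f_eq[OF g_fvec[OF t]] g_eq[OF t] by simp
    also have "\<dots> = \<zero>\<^bsub>M\<^esub>" using a.f_closed[OF c(1)] by (simp add: a_minus_def M.M.r_neg)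
    finally show ?thesis using h.f_closed[OF c(1)] by (simp add: rel_def fmod_def)
  qed
  have s_fvec: "s \<in> fvec R p" using s by (simp add: rel_def)
  have s_lspan: "s \<in> lspan (fmod R p) n (fvec R p)" using s rel_n s_fvec by (intro n_fvec_lspan) auto
  have sub: "submodule (rel R M y p) R (fmod R p)" by (rule rel_submodule[OF M y])
  have relF: "rel R M y p \<subseteq> carrier (fmod R p)" by (auto simp: rel_def fmod_def)
  let ?L = "lspan (fmod R p) n (rel R M y p)"
  have L: "submodule ?L R (fmod R p)" by (rule lspan_n_submodule[OF fmod_module relF])
  \<comment> \<open>The map \<open>?h\<close> sends the whole free module into the relations, so it
    sends \<open>s\<close>, whose entries lie in \<open>n\<close>, into n times the
    relations.\<close>
  have "?h s \<in> lspan (fmod R p) n (?h ` fvec R p)"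
    using s_lspan h.image_lspan[OF n_carrier, of "fvec R p"] by (auto simp: fmod_def)
  then have hs: "?h s \<in> ?L"
    using f.Q.lspan_mono[OF subset_refl, of "?h ` fvec R p" "rel R M y p"] h_rel by auto
  show ?thesis
  proof (intro bexI[of _ "?g s"] conjI)
    show gs: "?g s \<in> rel R M e b"
      using g_eq[OF s_fvec] g_fvec[OF s_fvec] s by (simp add: rel_def)
    show "\<forall>j. ?g s j \<in> n"
    proof
      fix j
      have "?g s = (\<lambda>i. \<Oplus>j\<in>{..<p}. s j \<otimes> \<beta> j i)"
        using s_fvec \<beta>(1) by (intro aug_fmod) (auto intro: fvec_carrier is_cring)
      moreover have "(\<Oplus>i\<in>{..<p}. s i \<otimes> \<beta> i j) \<in> n"
        using s rel_n \<beta>(1) by (intro n_finsum n.I_r_closed) (auto intro: fvec_carrier is_cring)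
      ultimately show "?g s j \<in> n" by simp
    qed
    show "?g s \<notin> lspan (fmod R b) n (rel R M e b)"
    proof
      assume "?g s \<in> lspan (fmod R b) n (rel R M e b)"
      then have "?f (?g s) \<in> lspan (fmod R p) n (?f ` rel R M e b)"
        using f.image_lspan[OF n_carrier, of "rel R M e b"] by (auto simp: rel_def fmod_def)
      moreover have "?f ` rel R M e b \<subseteq> rel R M y p"
        using f_fvec f_eq by (auto simp: rel_def)
      ultimately have "?f (?g s) \<in> ?L"
        using f.Q.lspan_mono[OF subset_refl, of "?f ` rel R M e b" "rel R M y p"] by auto
      then have "?h s \<oplus>\<^bsub>fmod R p\<^esub> ?f (?g s) \<in> ?L" using hs f.Q.submoduleE(5)[OF L] by blast
      moreover have "?h s \<oplus>\<^bsub>fmod R p\<^esub> ?f (?g s) = s"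
      proof -
        have "s \<in> carrier (fmod R p)" "?f (?g s) \<in> carrier (fmod R p)"
          using s_fvec f_fvec g_fvec by (simp_all add: fmod_def)
        then show ?thesis by (simp add: a_minus_def f.Q.M.a_assoc f.Q.M.l_neg)
      qed
      ultimately show False using s_notin by simp
    qed
  qed
qed

end

text \<open>The ideal \<open>Q\<close> contains the square of \<open>n\<close>, so \<open>x\<close>
  is a socle element outside that square. An explicit \<open>Q\<close> makes this easy to verify for
  R(k).\<close>

locale socle_local_cring = local_cring +
  fixes Q x
  assumes Q_ideal: "ideal Q R" and n_mult: "\<lbrakk>a \<in> n; b \<in> n\<rbrakk> \<Longrightarrow> a \<otimes> b \<in> Q"
    and x_in_n: "x \<in> n" and x_notin_Q: "x \<notin> Q" and x_socle: "a \<in> n \<Longrightarrow> a \<otimes> x = \<zero>"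
begin

text \<open>Write D and E for the maps of \<open>A\<close> and \<open>B\<close>. Since D(w) has
  entries in \<open>n\<close>, multiplying by \<open>x\<close> kills it, so x w = E(u) for some u.
  The functional \<psi> sends the image of E into \<open>n\<close>, hence n times that image into
  \<open>Q\<close>, whereas it sends x w to \<open>x\<close> times a unit.\<close>

lemma socle_step:
  assumes A: "\<And>i j. i < b' \<Longrightarrow> j < b \<Longrightarrow> A i j \<in> carrier R"
    and ker: "{v \<in> fvec R b. mat_app R A b' b v = (\<lambda>_. \<zero>)} = mat_app R B b c ` fvec R c"
    and w: "w \<in> fvec R b" and wn: "\<And>j. mat_app R A b' b w j \<in> n"
    and notin: "mat_app R A b' b w \<notin> lspan (fmod R b') n (mat_app R A b' b ` fvec R b)"
  shows "\<exists>u\<in>fvec R c. (\<forall>a\<in>n. \<forall>j. a \<otimes> mat_app R B b c u j = \<zero>) \<and> (\<forall>j. mat_app R B b c u j \<in> n) \<and>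
    mat_app R B b c u \<notin> lspan (fmod R b) n (mat_app R B b c ` fvec R c)"
proof -
  interpret Q: ideal Q R by (rule Q_ideal)
  let ?D = "mat_app R A b' b" and ?E = "mat_app R B b c"
  interpret D: linear_map R "fmod R b" "fmod R b'" ?D by (rule mat_app_linear_map[OF A])
  have xR: "x \<in> carrier R" using x_in_n by (rule n.Icarr)
  obtain \<psi> where \<psi>: "\<And>j. j < b \<Longrightarrow> \<psi> j \<in> carrier R"
    and \<psi>n: "\<And>g. g \<in> fvec R b \<Longrightarrow> ?D g = (\<lambda>_. \<zero>) \<Longrightarrow> aug (smod R) \<psi> b g \<in> n"
    and \<psi>w: "aug (smod R) \<psi> b w \<notin> n"
    using matrix_functional[OF A w notin] by blast
  let ?d = "aug (smod R) \<psi> b"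
  interpret d: linear_map R "fmod R b" "smod R" ?d
    using \<psi> by (intro aug_linear_map smod_module) (auto simp: smod_def)
  have wF: "w \<in> carrier (fmod R b)" using w by (simp add: fmod_def)
  have wR: "\<And>j. w j \<in> carrier R" using w by (rule fvec_carrier[OF is_cring])
  let ?u = "\<lambda>j. x \<otimes> w j"
  have u: "?u \<in> fvec R b" "?u = x \<odot>\<^bsub>fmod R b\<^esub> w" using xR w by (auto simp: fvec_smult fmod_def)
  have "?D ?u = x \<odot>\<^bsub>fmod R b'\<^esub> ?D w" unfolding u(2) using xR wF by (rule D.f_smult)
  also have "\<dots> = (\<lambda>_. \<zero>)"
    using x_socle[OF wn] xR n.Icarr[OF wn] by (simp add: fmod_def m_comm fun_eq_iff)
  finally have "?u \<in> ?E ` fvec R c" using u ker by auto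
  then obtain t where t: "t \<in> fvec R c" "?E t = ?u" by auto
  have EF: "?E ` fvec R c \<subseteq> carrier (fmod R b)"
    unfolding ker[symmetric] by (simp add: fmod_def subset_iff)
  have "?E t \<notin> lspan (fmod R b) n (?E ` fvec R c)"
  proof
    assume "?E t \<in> lspan (fmod R b) n (?E ` fvec R c)"
    then have "?d (?E t) \<in> lspan (smod R) n (?d ` (?E ` fvec R c))"
      unfolding d.image_lspan[OF n_carrier EF, symmetric] by (rule imageI)
    then have "?d ?u \<in> lspan (smod R) n (?d ` (?E ` fvec R c))" unfolding t(2) .
    moreover have "lspan (smod R) n (?d ` (?E ` fvec R c)) \<subseteq> Q"
    proof (rule d.Q.lspan_subset_submoduleI)
      show "submodule Q R (smod R)"
        using Q.Icarr by (intro d.Q.submodule_criterion) (auto simp: smod_def Q.I_l_closed)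
      fix a g assume a: "a \<in> n" and "g \<in> ?d ` (?E ` fvec R c)"
      then obtain v where v: "v \<in> ?E ` fvec R c" "g = ?d v" by blast
      have "?d v \<in> n" using v ker \<psi>n by blast
      then show "a \<odot>\<^bsub>smod R\<^esub> g \<in> Q" using n_mult a v by (simp add: smod_def)
    qed
    ultimately have "?d ?u \<in> Q" by blast
    moreover have "?d ?u = x \<otimes> ?d w" unfolding u(2) using d.f_smult[OF xR wF] by (simp add: smod_def)
    ultimately have xd: "x \<otimes> ?d w \<in> Q" by simp
    have dw: "?d w \<in> carrier R" using d.f_closed[OF wF] by (simp add: smod_def)
    then have un: "?d w \<in> Units R" using unit \<psi>w by simp
    then have "x \<otimes> ?d w \<otimes> inv (?d w) \<in> Q" using Q.I_r_closed[OF xd] by simp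
    then show False using x_notin_Q xR dw un by (simp add: m_assoc)
  qed
  moreover have "\<forall>a\<in>n. \<forall>j. a \<otimes> ?E t j = \<zero>"
    using xR wR x_socle by (auto simp: t(2) m_assoc[symmetric] n.Icarr)
  moreover have "\<forall>j. ?E t j \<in> n" using x_in_n wR by (simp add: t(2) n.I_r_closed)
  ultimately show ?thesis using t(1) by blast
qed

end

section \<open>Tor cycles that are not boundaries\<close>

context local_cring
begin

text \<open>Here \<open>A\<close>, \<open>B\<close>, \<open>C\<close> are three consecutive
  differentials, and the cycle has coefficients in the source of \<open>B\<close>. The tensor
  product of \<open>w\<close> with the relation \<open>s\<close> is zero, so a lift of the vectors
  s(j) w through \<open>B\<close> gives a cycle.\<close>

lemma tor_cycle_not_boundary:
  assumes N: "module R N" and fg: "fin_gen R N" and nonfree: "\<not> free_module R N"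
    and noeth: "noeth R (smod R)"
    and A: "\<And>i j. i < b0 \<Longrightarrow> j < b1 \<Longrightarrow> A i j \<in> carrier R"
    and B: "\<And>i j. i < b1 \<Longrightarrow> j < b2 \<Longrightarrow> B i j \<in> carrier R"
    and C: "\<And>i j. i < b2 \<Longrightarrow> j < b3 \<Longrightarrow> C i j \<in> carrier R"
    and kerA: "{v \<in> fvec R b1. mat_app R A b0 b1 v = (\<lambda>_. \<zero>)} = mat_app R B b1 b2 ` fvec R b2"
    and kerB: "{v \<in> fvec R b2. mat_app R B b1 b2 v = (\<lambda>_. \<zero>)} = mat_app R C b2 b3 ` fvec R b3"
    and w: "w \<in> fvec R b1" and wn: "\<And>a j. a \<in> n \<Longrightarrow> a \<otimes> mat_app R A b0 b1 w j = \<zero>"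
    and notin: "mat_app R A b0 b1 w \<notin> lspan (fmod R b0) n (mat_app R A b0 b1 ` fvec R b1)"
  shows "\<exists>Z\<in>mvec N b2. mat_appN N B b1 b2 Z = (\<lambda>_. \<zero>\<^bsub>N\<^esub>) \<and> Z \<notin> mat_appN N C b2 b3 ` mvec N b3"
proof -
  interpret N: module R N by fact
  let ?A = "mat_app R A b0 b1" and ?B = "mat_app R B b1 b2" and ?C = "mat_app R C b2 b3"
  interpret A: linear_map R "fmod R b1" "fmod R b0" ?A by (rule mat_app_linear_map[OF A])
  interpret B: linear_map R "fmod R b2" "fmod R b1" ?B by (rule mat_app_linear_map[OF B])
  interpret C: linear_map R "fmod R b3" "fmod R b2" ?C by (rule mat_app_linear_map[OF C])
  obtain p y s where y0: "\<forall>j<p. y j \<in> carrier N" and gen: "carrier N \<subseteq> aug N y p ` fvec R p"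
    and rel_n: "\<forall>t\<in>rel R N y p. \<forall>j. t j \<in> n"
    and s: "s \<in> rel R N y p" and s_notin: "s \<notin> lspan (fmod R p) n (rel R N y p)"
    by (rule non_free_relation[OF N fg nonfree noeth])
  have y: "\<And>j. j < p \<Longrightarrow> y j \<in> carrier N" using y0 by simp
  interpret a: linear_map R "fmod R p" N "aug N y p" by (rule aug_linear_map[OF N y])
  have s_fvec: "s \<in> fvec R p" and s0: "aug N y p s = \<zero>\<^bsub>N\<^esub>" using s by (simp_all add: rel_def)
  have sF: "s \<in> carrier (fmod R p)" using s_fvec by (simp add: fmod_def)
  have sn: "s j \<in> n" for j using s rel_n by blast
  have sR: "s j \<in> carrier R" for j using sn by (rule n.Icarr)
  have wR: "w j \<in> carrier R" for j using w by (rule fvec_carrier[OF is_cring])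
  have wF: "w \<in> carrier (fmod R b1)" using w by (simp add: fmod_def)
  obtain \<psi> where \<psi>: "\<And>j. j < b1 \<Longrightarrow> \<psi> j \<in> carrier R"
    and \<psi>n: "\<And>g. g \<in> fvec R b1 \<Longrightarrow> ?A g = (\<lambda>_. \<zero>) \<Longrightarrow> aug (smod R) \<psi> b1 g \<in> n"
    and \<psi>w: "aug (smod R) \<psi> b1 w \<notin> n"
    using matrix_functional[OF A w notin] by blast
  let ?d = "aug (smod R) \<psi> b1"
  interpret d: linear_map R "fmod R b1" "smod R" ?d
    using \<psi> by (intro aug_linear_map smod_module) (auto simp: smod_def)
  \<comment> \<open>All entries of \<open>s\<close> lie in \<open>n\<close>, which kills the image
    of \<open>w\<close> under \<open>A\<close>. So each s(j) w is in the kernel of \<open>A\<close>,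
    that is, in the image of \<open>B\<close>.\<close>
  have "\<exists>z\<in>fvec R b2. ?B z = (\<lambda>i. s j \<otimes> w i)" for j
  proof -
    have eq: "(\<lambda>i. s j \<otimes> w i) = s j \<odot>\<^bsub>fmod R b1\<^esub> w" by (simp add: fmod_def)
    have "?A (\<lambda>i. s j \<otimes> w i) = s j \<odot>\<^bsub>fmod R b0\<^esub> ?A w"
      unfolding eq using sR wF by (rule A.f_smult)
    also have "\<dots> = (\<lambda>_. \<zero>)" using wn[OF sn] by (simp add: fmod_def)
    finally have "(\<lambda>i. s j \<otimes> w i) \<in> {v \<in> fvec R b1. ?A v = (\<lambda>_. \<zero>)}"
      using fvec_smult[OF sR w] by simp
    then have "(\<lambda>i. s j \<otimes> w i) \<in> ?B ` fvec R b2" unfolding kerA .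
    then show ?thesis by (metis imageE)
  qed
  then obtain z where z: "\<And>j. z j \<in> fvec R b2" "\<And>j. ?B (z j) = (\<lambda>i. s j \<otimes> w i)" by metis
  have zR: "z j l \<in> carrier R" for j l using z(1) by (rule fvec_carrier[OF is_cring])
  \<comment> \<open>In coordinates, this is the sum of the tensors of z(j) with y(j).\<close>
  define Z where "Z = (\<lambda>l. if l < b2 then aug N y p (\<lambda>j. z j l) else \<zero>\<^bsub>N\<^esub>)"
  have Z_mvec: "Z \<in> mvec N b2" using zR y by (auto simp: mvec_def Z_def intro: N.aug_closed)
  have "mat_appN N B b1 b2 Z = (\<lambda>_. \<zero>\<^bsub>N\<^esub>)"
  proof
    fix i
    show "mat_appN N B b1 b2 Z i = \<zero>\<^bsub>N\<^esub>"
    proof (cases "i < b1")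
      case True
      have Bz: "(\<Oplus>l\<in>{..<b2}. B i l \<otimes> z j l) = s j \<otimes> w i" for j
        using fun_cong[OF z(2)[of j], of i] True by (simp add: mat_app_def)
      have "mat_appN N B b1 b2 Z i = aug N Z b2 (B i)"
        using True by (simp add: mat_appN_def aug_def)
      also have "\<dots> = aug N (\<lambda>l. aug N y p (\<lambda>j. z j l)) b2 (B i)"
        using B True zR y by (intro N.aug_cong) (auto simp: Z_def intro: N.aug_closed)
      also have "\<dots> = aug N y p (\<lambda>j. s j \<otimes> w i)"
        using B True zR y by (subst N.aug_aug) (auto simp: Bz)
      also have "\<dots> = aug N y p (\<lambda>j. w i \<otimes> s j)"
        using sR wR by (simp add: m_comm)
      also have "\<dots> = w i \<odot>\<^bsub>N\<^esub> aug N y p s"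
        using sR wR y by (intro N.aug_smult)
      finally show ?thesis using s0 wR by simp
    qed (simp add: mat_appN_def)
  qed
  moreover have "Z \<notin> mat_appN N C b2 b3 ` mvec N b3"
  proof
    assume "Z \<in> mat_appN N C b2 b3 ` mvec N b3"
    then obtain T where T: "T \<in> mvec N b3" "Z = mat_appN N C b2 b3 T" by blast
    have "\<forall>q\<in>{..<b3}. \<exists>t\<in>fvec R p. T q = aug N y p t"
      using T(1) gen by (auto simp: mvec_def)
    then obtain t where t: "\<And>q. q < b3 \<Longrightarrow> t q \<in> fvec R p" "\<And>q. q < b3 \<Longrightarrow> T q = aug N y p (t q)"
      by (metis lessThan_iff)
    have tR: "t q j \<in> carrier R" if "q < b3" for q j
      using t(1)[OF that] by (rule fvec_carrier[OF is_cring])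
    \<comment> \<open>The preimage \<open>T\<close> is the sum of the tensors of t'(j) with y(j). So
      correcting z(j) by the image of t'(j) leaves vectors \<zeta>(j) whose tensors with y(j) sum to
      zero.\<close>
    define t' where "t' = (\<lambda>j q. if q < b3 then t q j else \<zero>)"
    have t': "t' j \<in> fvec R b3" for j using tR by (auto simp: t'_def fvec_def)
    have Ct': "?C (t' j) l = (\<Oplus>q\<in>{..<b3}. C l q \<otimes> t q j)" if "l < b2" for j l
      using that C tR by (auto simp: mat_app_def t'_def intro!: finsum_cong')
    have Ct'F: "?C (t' j) \<in> fvec R b2" for j using C.f_closed[of "t' j"] t' by (simp add: fmod_def)
    have Ct'R: "?C (t' j) l \<in> carrier R" for j l using Ct'F by (rule fvec_carrier[OF is_cring])
    define \<zeta> where "\<zeta> = (\<lambda>j. z j \<ominus>\<^bsub>fmod R b2\<^esub> ?C (t' j))"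
    have \<zeta>_eq: "\<zeta> j = (\<lambda>l. z j l \<ominus> ?C (t' j) l)" for j
      unfolding \<zeta>_def by (rule fmod_minus[OF z(1) Ct'F])
    have zF: "z j \<in> carrier (fmod R b2)" and CF: "?C (t' j) \<in> carrier (fmod R b2)" for j
      using z(1) Ct'F by (simp_all add: fmod_def)
    have \<zeta>F: "\<zeta> j \<in> fvec R b2" for j
      using B.P.M.minus_closed[OF zF CF] by (simp add: \<zeta>_def fmod_def)
    \<comment> \<open>Transposing \<zeta>: at a fixed coordinate \<open>l\<close>, its entries are
      the coefficients of a relation among the \<open>y j\<close>, cut off at \<open>p\<close> to
      lie in \<open>fvec R p\<close>.\<close>
    define \<rho> where "\<rho> = (\<lambda>l j. if j < p then \<zeta> j l else \<zero>)"
    have \<rho>_rel: "\<rho> l \<in> rel R N y p" if l: "l < b2" for l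
    proof -
      have \<zeta>R: "\<zeta> j l \<in> carrier R" for j using \<zeta>F by (rule fvec_carrier[OF is_cring])
      have "aug N y p (\<lambda>j. ?C (t' j) l) = aug N y p (\<lambda>j. \<Oplus>q\<in>{..<b3}. C l q \<otimes> t q j)"
        using Ct' l by simp
      also have "\<dots> = aug N (\<lambda>q. aug N y p (t q)) b3 (C l)"
        using C l tR y by (intro N.aug_aug[symmetric]) auto
      also have "\<dots> = aug N T b3 (C l)"
        using C l t tR y by (intro N.aug_cong) (auto simp: mvec_def intro: N.aug_closed)
      also have "\<dots> = Z l" using l T(2) by (simp add: mat_appN_def aug_def)
      also have "\<dots> = aug N y p (\<lambda>j. z j l)" using l by (simp add: Z_def)
      also have "\<dots> = aug N y p (\<lambda>j. \<zeta> j l \<oplus> ?C (t' j) l)"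
        using zR Ct'R by (simp add: \<zeta>_eq a_minus_def a_assoc l_neg)
      also have "\<dots> = aug N y p (\<lambda>j. \<zeta> j l) \<oplus>\<^bsub>N\<^esub> aug N y p (\<lambda>j. ?C (t' j) l)"
        using \<zeta>R Ct'R y by (intro N.aug_add)
      finally have "aug N y p (\<lambda>j. \<zeta> j l) = \<zero>\<^bsub>N\<^esub>"
        using N.aug_closed[of p "\<lambda>j. \<zeta> j l" y] N.aug_closed[of p "\<lambda>j. ?C (t' j) l" y] \<zeta>R Ct'R y
        by (metis N.M.add.r_cancel_one)
      moreover have "aug N y p (\<rho> l) = aug N y p (\<lambda>j. \<zeta> j l)"
        using \<zeta>R y by (intro N.aug_cong) (auto simp: \<rho>_def)
      moreover have "\<rho> l \<in> fvec R p" using \<zeta>R by (auto simp: \<rho>_def fvec_def)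
      ultimately show ?thesis by (simp add: rel_def)
    qed
    interpret k: linear_map R "fmod R b2" "smod R" "\<lambda>v. ?d (?B v)"
      by (rule linear_map_comp[OF B.linear_map_axioms d.linear_map_axioms])
    define \<eta> where "\<eta> = (\<lambda>l. ?d (?B (unit_vec l)))"
    \<comment> \<open>The columns of \<open>B\<close> lie in the kernel of \<open>A\<close>, where
      \<psi> takes values in \<open>n\<close>.\<close>
    have \<eta>n: "\<eta> l \<in> n" if "l < b2" for l
    proof -
      have "?B (unit_vec l) \<in> ?B ` fvec R b2" using unit_vec_fvec[OF that] by (rule imageI)
      then have "?B (unit_vec l) \<in> {v \<in> fvec R b1. ?A v = (\<lambda>_. \<zero>)}" unfolding kerA .
      then show ?thesis using \<psi>n by (simp add: \<eta>_def)
    qed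
    have dw: "?d w \<in> carrier R" using d.f_closed[OF wF] by (simp add: smod_def)
    \<comment> \<open>The correction by an element of the image of \<open>C\<close> is invisible to
      \<open>B\<close>, so \<zeta>(j) still maps to s(j) w. Apply \<psi> and expand \<zeta>(j) in
      unit vectors.\<close>
    have key: "s j \<otimes> ?d w = (\<Oplus>l\<in>{..<b2}. \<eta> l \<otimes> \<zeta> j l)" for j
    proof -
      have "?C (t' j) \<in> ?C ` fvec R b3" using t' by (rule imageI)
      then have "?C (t' j) \<in> {v \<in> fvec R b2. ?B v = (\<lambda>_. \<zero>)}" unfolding kerB .
      then have BC: "?B (?C (t' j)) = \<zero>\<^bsub>fmod R b1\<^esub>" by (simp add: fmod_def)
      have \<zeta>C: "\<zeta> j \<in> carrier (fmod R b2)" using \<zeta>F by (simp add: fmod_def)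
      have "z j = \<zeta> j \<oplus>\<^bsub>fmod R b2\<^esub> ?C (t' j)"
        using zR Ct'R by (simp add: fmod_def \<zeta>_eq a_minus_def a_assoc l_neg)
      then have "?B (z j) = ?B (\<zeta> j) \<oplus>\<^bsub>fmod R b1\<^esub> ?B (?C (t' j))"
        using B.f_add[OF \<zeta>C CF, of j] by simp
      also have "\<dots> = ?B (\<zeta> j)" using B.f_closed[OF \<zeta>C] by (simp add: BC)
      finally have "?B (\<zeta> j) = s j \<odot>\<^bsub>fmod R b1\<^esub> w" by (simp add: z(2)) (simp add: fmod_def)
      then have "?d (?B (\<zeta> j)) = s j \<otimes> ?d w"
        using d.f_smult[OF sR wF] by (simp add: smod_def)
      moreover have "?d (?B (\<zeta> j)) = ?d (?B (aug (fmod R b2) unit_vec b2 (\<zeta> j)))"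
        using aug_unit_vec[OF \<zeta>F] by simp
      moreover have "\<dots> = aug (smod R) \<eta> b2 (\<zeta> j)"
        unfolding \<eta>_def using \<zeta>F unit_vec_fvec
        by (intro k.f_aug) (auto simp: fmod_def intro: fvec_carrier is_cring)
      moreover have "\<dots> = (\<Oplus>l\<in>{..<b2}. \<eta> l \<otimes> \<zeta> j l)"
        unfolding aug_smod using \<eta>n fvec_carrier[OF is_cring \<zeta>F]
        by (intro finsum_cong') (auto intro: m_comm n.Icarr)
      ultimately show ?thesis by simp
    qed
    have \<rho>F: "\<rho> l \<in> fvec R p" if "l < b2" for l using \<rho>_rel[OF that] by (simp add: rel_def)
    have \<eta>R: "\<eta> l \<in> carrier R" if "l < b2" for l using \<eta>n[OF that] by (rule n.Icarr)
    \<comment> \<open>Collecting these equations over all \<open>j\<close> writes the unit \<psi>(w)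
      times \<open>s\<close> as a combination of relations with coefficients in \<open>n\<close>;
      cancelling the unit contradicts the choice of \<open>s\<close>.\<close>
    have "?d w \<odot>\<^bsub>fmod R p\<^esub> s = aug (fmod R p) \<rho> b2 \<eta>"
    proof
      fix j
      have *: "aug (fmod R p) \<rho> b2 \<eta> j = (\<Oplus>l\<in>{..<b2}. \<eta> l \<otimes> \<rho> l j)"
        using \<rho>F \<eta>R by (subst aug_fmod) auto
      show "(?d w \<odot>\<^bsub>fmod R p\<^esub> s) j = aug (fmod R p) \<rho> b2 \<eta> j"
      proof (cases "j < p")
        case True
        have "(?d w \<odot>\<^bsub>fmod R p\<^esub> s) j = s j \<otimes> ?d w"
          using dw sR by (simp add: fmod_def m_comm)
        also have "\<dots> = (\<Oplus>l\<in>{..<b2}. \<eta> l \<otimes> \<zeta> j l)" by (rule key)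
        also have "\<dots> = (\<Oplus>l\<in>{..<b2}. \<eta> l \<otimes> \<rho> l j)" using True by (simp add: \<rho>_def)
        finally show ?thesis using * by simp
      next
        case False
        have "(\<Oplus>l\<in>{..<b2}. \<eta> l \<otimes> \<rho> l j) = (\<Oplus>l\<in>{..<b2}. \<zero>)"
          using False \<eta>R by (intro finsum_cong') (auto simp: \<rho>_def)
        then show ?thesis using * False s_fvec dw by (simp add: fmod_def fvec_def)
      qed
    qed
    moreover have relF: "rel R N y p \<subseteq> carrier (fmod R p)" by (auto simp: rel_def fmod_def)
    moreover have "aug (fmod R p) \<rho> b2 \<eta> \<in> lspan (fmod R p) n (rel R N y p)"
      using n_carrier relF \<eta>n \<rho>_rel by (rule a.P.lspan_aug)
    ultimately have "?d w \<odot>\<^bsub>fmod R p\<^esub> s \<in> lspan (fmod R p) n (rel R N y p)" by simp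
    moreover have "?d w \<in> Units R" using unit dw \<psi>w by simp
    ultimately have "inv (?d w) \<odot>\<^bsub>fmod R p\<^esub> (?d w \<odot>\<^bsub>fmod R p\<^esub> s) \<in> lspan (fmod R p) n (rel R N y p)"
      using a.P.submoduleE(4)[OF lspan_n_submodule[OF fmod_module relF]] by simp
    then have "s \<in> lspan (fmod R p) n (rel R N y p)"
      using \<open>?d w \<in> Units R\<close> dw sF by (simp add: a.P.smult_assoc1[symmetric])
    then show False using s_notin by simp
  qed
  ultimately show ?thesis using Z_mvec by blast
qed

end

context socle_local_cring
begin

theorem tor_nonzero:
  assumes noeth: "noeth R (smod R)"
    and M: "module R M" "fin_gen R M" "\<not> free_module R M"
    and N: "module R N" "fin_gen R N" "\<not> free_module R N" and k: "k \<ge> 3"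
  shows "\<not> Tor_zero R M N k"
proof -
  \<comment> \<open>Both cycles and boundaries refer to this same chosen resolution.\<close>
  obtain b d e where res: "(SOME res. free_resolution R M res) = (b, d, e)" by (cases "SOME res. free_resolution R M res")
  have "free_resolution R M (b, d, e)"
    unfolding res[symmetric] using free_resolution_exists[OF M(1,2) noeth] by (rule someI_ex)
  then have e: "\<And>j. j < b 0 \<Longrightarrow> e j \<in> carrier M"
    and d: "\<And>i r c. i \<ge> 1 \<Longrightarrow> r < b (i - 1) \<Longrightarrow> c < b i \<Longrightarrow> d i r c \<in> carrier R"
    and surj: "aug M e (b 0) ` fvec R (b 0) = carrier M"
    and ker0: "{v \<in> fvec R (b 0). aug M e (b 0) v = \<zero>\<^bsub>M\<^esub>} = mat_app R (d 1) (b 0) (b 1) ` fvec R (b 1)"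
    and ker: "\<And>i. i \<ge> 1 \<Longrightarrow> {v \<in> fvec R (b i). mat_app R (d i) (b (i - 1)) (b i) v = (\<lambda>_. \<zero>)}
        = mat_app R (d (Suc i)) (b i) (b (Suc i)) ` fvec R (b (Suc i))"
    unfolding free_resolution_def by auto
  let ?D = "\<lambda>i. mat_app R (d (Suc i)) (b i) (b (Suc i))"
  have dS: "\<And>r c. r < b i \<Longrightarrow> c < b (Suc i) \<Longrightarrow> d (Suc i) r c \<in> carrier R" for i
    using d[of "Suc i"] by simp
  have kerS: "{v \<in> fvec R (b (Suc i)). ?D i v = (\<lambda>_. \<zero>)} = ?D (Suc i) ` fvec R (b (Suc (Suc i)))" for i
    using ker[of "Suc i"] by simp
  \<comment> \<open>Since \<open>?D i\<close> is the differential with index i + 1,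
    \<open>?P i w\<close> says that \<open>w\<close> witnesses that i + 1 is good.\<close>
  let ?P = "\<lambda>i w. w \<in> fvec R (b (Suc i)) \<and> (\<forall>j. ?D i w j \<in> n) \<and>
    ?D i w \<notin> lspan (fmod R (b i)) n (?D i ` fvec R (b (Suc i)))"
  have step: "\<exists>u. ?P (Suc i) u \<and> (\<forall>a\<in>n. \<forall>j. a \<otimes> ?D (Suc i) u j = \<zero>)" if w: "?P i w" for i w
    using socle_step[OF dS kerS] w by blast
  have "\<exists>w. ?P i w" for i
  proof (induction i)
    case 0
    obtain c where c: "c \<in> rel R M e (b 0)" "\<forall>j. c j \<in> n"
      "c \<notin> lspan (fmod R (b 0)) n (rel R M e (b 0))"
      using syzygy_notin_n_syzygies[OF M noeth e surj] by blast
    have rel: "rel R M e (b 0) = ?D 0 ` fvec R (b (Suc 0))" using ker0 by (simp add: rel_def)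
    then obtain w where "w \<in> fvec R (b (Suc 0))" "c = ?D 0 w" using c(1) by blast
    then show ?case using c rel by auto
  next
    case (Suc i)
    then show ?case using step by blast
  qed
  \<comment> \<open>A witness killed by \<open>n\<close> arises from one step, hence first for the
    differential \<open>d 2\<close>. For Tor in degree \<open>k\<close> it is needed for
    \<open>d (k - 1)\<close>, which is where k \<ge> 3 enters.\<close>
  then obtain w where w: "?P (Suc (k - 3)) w" "\<forall>a\<in>n. \<forall>j. a \<otimes> ?D (Suc (k - 3)) w j = \<zero>"
    using step by meson
  define m where "m = Suc (k - 3)"
  have km: "k = Suc (Suc m)" using k by (simp add: m_def)
  \<comment> \<open>The three consecutive differentials are those with indices k - 1, k and k +
    1.\<close>
  have "\<exists>Z\<in>mvec N (b k). mat_appN N (d k) (b (k - 1)) (b k) Z = (\<lambda>_. \<zero>\<^bsub>N\<^esub>) \<and>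
      Z \<notin> mat_appN N (d (Suc k)) (b k) (b (Suc k)) ` mvec N (b (Suc k))"
    unfolding km diff_Suc_1
    by (rule tor_cycle_not_boundary[OF N noeth dS dS dS kerS kerS, where w = w])
      (use w in \<open>auto simp: m_def\<close>)
  then show ?thesis
    using k by (auto simp: Tor_zero_def tor_cycles_def tor_boundaries_def res)
qed

end

section \<open>The trivial extension by the residue field\<close>

text \<open>Zorn's lemma on the proper ideals above \<open>I\<close>: in a Noetherian ring a
  nonempty chain of ideals contains its union, so the union is again proper.\<close>

lemma (in ring) exists_maximalideal:
  assumes noeth: "Ring_Divisibility.noetherian_ring R" and I: "ideal I R" "I \<noteq> carrier R"
  shows "\<exists>J. maximalideal J R \<and> I \<subseteq> J"
proof -
  define A where "A = {J. ideal J R \<and> I \<subseteq> J \<and> J \<noteq> carrier R}"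
  have "\<exists>J\<in>A. (\<forall>L\<in>A. (J \<subseteq> L) \<longrightarrow> (L = J))"
  proof (rule subset_Zorn_nonempty)
    show "A \<noteq> {}" using I by (auto simp: A_def)
    fix C assume C: "C \<noteq> {}" "subset.chain A C"
    then have "subset.chain {I. ideal I R} C" by (auto simp: subset.chain_def A_def)
    with C(1) have "\<Union>C \<in> C" by (rule noetherian_ring.ideal_chain_is_trivial[OF noeth])
    then show "\<Union>C \<in> A" using C(2) by (auto simp: subset.chain_def)
  qed
  then obtain J where J: "ideal J R" "I \<subseteq> J" "J \<noteq> carrier R"
    and max: "\<forall>L\<in>A. (J \<subseteq> L) \<longrightarrow> (L = J)" by (auto simp: A_def)
  have "maximalideal J R"
  proof (rule maximalidealI)
    show "L = J \<or> L = carrier R" if "ideal L R" "J \<subseteq> L" "L \<subseteq> carrier R" for L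
    proof (cases "L = carrier R")
      case False
      then have "L \<in> A" using that J by (auto simp: A_def)
      then show ?thesis using max that by blast
    qed simp
  qed (use J in auto)
  then show ?thesis using J by blast
qed

locale residue_ext = cring +
  fixes m
  assumes m_maximal: "maximalideal m R"
    and unit_if: "\<lbrakk>a \<in> carrier R; a \<notin> m\<rbrakk> \<Longrightarrow> a \<in> Units R"
    and noetherian: "Ring_Divisibility.noetherian_ring R"
begin

sublocale m: maximalideal m R by (rule m_maximal)

lemma K_field: "field (R Quot m)"
  using m.quotient_is_field[OF cring_axioms] .

end

sublocale residue_ext \<subseteq> K: field "R Quot m"
  by (rule K_field)

sublocale residue_ext \<subseteq> pr: ring_hom_ring R "R Quot m" "(+>) m"
  by (rule m.rcos_ring_hom_ring)

section \<open>Arithmetic, ideals and units of R(k)\<close>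

context residue_ext
begin

abbreviation "K \<equiv> R Quot m"
abbreviation "pr a \<equiv> m +> a"
abbreviation "S \<equiv> triv_ext R (residue_module R m)"

lemma pr_eq_zero:
  assumes a: "a \<in> carrier R"
  shows "pr a = \<zero>\<^bsub>K\<^esub> \<longleftrightarrow> a \<in> m"
proof
  have K0: "\<zero>\<^bsub>K\<^esub> = m" by (simp only: FactRing_def ring_record_simps)
  show "a \<in> m" if "pr a = \<zero>\<^bsub>K\<^esub>"
    using that unfolding K0 by (rule m.rcos_const_imp_mem[OF a])
  show "pr a = \<zero>\<^bsub>K\<^esub>" if "a \<in> m"
    unfolding K0 by (rule a_rcos_zero[OF m.is_ideal that])
qed

lemma pr_surj:
  assumes "k \<in> carrier K"
  shows "\<exists>a\<in>carrier R. k = pr a"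
proof -
  have "k \<in> (\<Union>a\<in>carrier R. {pr a})" using assms unfolding FactRing_def A_RCOSETS_def' by simp
  then show ?thesis by (elim UN_E) (intro bexI, simp_all)
qed

text \<open>An element of \<open>R\<close> acts on the residue field as multiplication by its class,
  so computations in R(k) reduce to ring arithmetic in \<open>R\<close> and
  \<open>K\<close>.\<close>

lemma S_simps:
  "carrier S = carrier R \<times> carrier K"
  "(a, k) \<otimes>\<^bsub>S\<^esub> (b, l) = (a \<otimes> b, pr a \<otimes>\<^bsub>K\<^esub> l \<oplus>\<^bsub>K\<^esub> pr b \<otimes>\<^bsub>K\<^esub> k)"
  "(a, k) \<oplus>\<^bsub>S\<^esub> (b, l) = (a \<oplus> b, k \<oplus>\<^bsub>K\<^esub> l)"
  "\<one>\<^bsub>S\<^esub> = (\<one>, \<zero>\<^bsub>K\<^esub>)" "\<zero>\<^bsub>S\<^esub> = (\<zero>, \<zero>\<^bsub>K\<^esub>)"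
  by (simp_all add: triv_ext_def residue_module_def)

lemma S_cring: "cring S"
proof (rule cringI)
  show "abelian_group S"
  proof (rule abelian_groupI)
    fix s assume "s \<in> carrier S"
    then obtain a k where s: "s = (a, k)" "a \<in> carrier R" "k \<in> carrier K" by (auto simp: S_simps)
    then show "\<exists>t\<in>carrier S. t \<oplus>\<^bsub>S\<^esub> s = \<zero>\<^bsub>S\<^esub>"
      by (intro bexI[of _ "(\<ominus> a, \<ominus>\<^bsub>K\<^esub> k)"]) (auto simp: S_simps l_neg K.l_neg)
  qed (auto simp: S_simps a_ac K.a_ac)
  show "comm_monoid S"
  proof (rule comm_monoidI)
    fix s t assume "s \<in> carrier S" "t \<in> carrier S"
    then show "s \<otimes>\<^bsub>S\<^esub> t = t \<otimes>\<^bsub>S\<^esub> s" by (auto simp: S_simps m_comm K.a_comm)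
  next
    fix s t u assume "s \<in> carrier S" "t \<in> carrier S" "u \<in> carrier S"
    then show "s \<otimes>\<^bsub>S\<^esub> t \<otimes>\<^bsub>S\<^esub> u = s \<otimes>\<^bsub>S\<^esub> (t \<otimes>\<^bsub>S\<^esub> u)"
      by (auto simp: S_simps m_assoc K.r_distr K.m_ac K.a_ac)
  qed (auto simp: S_simps)
  fix s t u assume "s \<in> carrier S" "t \<in> carrier S" "u \<in> carrier S"
  then show "(s \<oplus>\<^bsub>S\<^esub> t) \<otimes>\<^bsub>S\<^esub> u = s \<otimes>\<^bsub>S\<^esub> u \<oplus>\<^bsub>S\<^esub> t \<otimes>\<^bsub>S\<^esub> u"
    by (auto simp: S_simps l_distr K.l_distr K.r_distr K.a_ac)
qed

text \<open>In a product with an element of m \<times> J, the mixed term coming from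
  \<open>m\<close> vanishes, because \<open>m\<close> acts as zero on \<open>K\<close>. Taking
  \<open>J\<close> to be all of \<open>K\<close> or zero gives the ideals \<open>n\<close> and
  \<open>Q\<close> for R(k).\<close>

lemma S_idealI:
  assumes J: "\<zero>\<^bsub>K\<^esub> \<in> J" "J \<subseteq> carrier K" "\<And>k l. \<lbrakk>k \<in> J; l \<in> J\<rbrakk> \<Longrightarrow> k \<oplus>\<^bsub>K\<^esub> l \<in> J"
    "\<And>k l. \<lbrakk>k \<in> carrier K; l \<in> J\<rbrakk> \<Longrightarrow> k \<otimes>\<^bsub>K\<^esub> l \<in> J"
  shows "ideal (m \<times> J) S"
proof -
  interpret S: cring S by (rule S_cring)
  interpret M: module S "smod S" by (rule S.smod_module)
  have mult: "s \<otimes>\<^bsub>S\<^esub> u \<in> m \<times> J" if s: "s \<in> carrier S" and u: "u \<in> m \<times> J" for s u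
  proof -
    obtain a k b l where *: "s = (a, k)" "a \<in> carrier R" "k \<in> carrier K" "u = (b, l)" "b \<in> m" "l \<in> J"
      using s u by (auto simp: S_simps)
    have "pr b \<otimes>\<^bsub>K\<^esub> k = \<zero>\<^bsub>K\<^esub>" using * pr_eq_zero[of b] m.Icarr[of b] by simp
    moreover have "pr a \<otimes>\<^bsub>K\<^esub> l \<in> J" using * J by simp
    moreover have "pr a \<otimes>\<^bsub>K\<^esub> l \<in> carrier K" using calculation(2) J by blast
    ultimately show ?thesis using * by (simp add: S_simps m.I_l_closed)
  qed
  have mJ: "m \<times> J \<subseteq> carrier S" using J m.Icarr by (auto simp: S_simps)
  have sub: "submodule (m \<times> J) S (smod S)"
  proof (rule M.submodule_criterion)
    show "m \<times> J \<subseteq> carrier (smod S)" using mJ by (simp add: smod_def)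
    show "\<zero>\<^bsub>smod S\<^esub> \<in> m \<times> J" using J by (simp add: smod_def S_simps)
    show "s \<oplus>\<^bsub>smod S\<^esub> t \<in> m \<times> J" if "s \<in> m \<times> J" "t \<in> m \<times> J" for s t
      using that J by (auto simp: smod_def S_simps)
    show "s \<odot>\<^bsub>smod S\<^esub> t \<in> m \<times> J" if "s \<in> carrier S" "t \<in> m \<times> J" for s t
      using mult[OF that] by (simp add: smod_def)
  qed
  show ?thesis
  proof (rule idealI)
    show "ring S" by (rule S.ring_axioms)
    show "subgroup (m \<times> J) (add_monoid S)"
    proof (rule S.add.subgroupI)
      show "m \<times> J \<noteq> {}" using J(1) m.zero_closed by blast
      show "\<ominus>\<^bsub>S\<^esub> s \<in> m \<times> J" if "s \<in> m \<times> J" for s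
      proof -
        have "\<ominus>\<^bsub>S\<^esub> \<one>\<^bsub>S\<^esub> \<otimes>\<^bsub>S\<^esub> s \<in> m \<times> J" using that by (intro mult) auto
        then show ?thesis using that mJ by (auto simp: S.l_minus subset_iff)
      qed
      show "s \<oplus>\<^bsub>S\<^esub> t \<in> m \<times> J" if "s \<in> m \<times> J" "t \<in> m \<times> J" for s t
        using that J by (auto simp: S_simps)
    qed (use mJ in auto)
    show "s \<otimes>\<^bsub>S\<^esub> u \<in> m \<times> J" if "u \<in> m \<times> J" "s \<in> carrier S" for s u using mult that by blast
    show "u \<otimes>\<^bsub>S\<^esub> s \<in> m \<times> J" if "u \<in> m \<times> J" "s \<in> carrier S" for s u
      using mult[OF that(2,1)] S.m_comm[of u s] that mJ by auto
  qed
qed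

lemma S_Units:
  assumes "s \<in> carrier S" "s \<notin> m \<times> carrier K"
  shows "s \<in> Units S"
proof -
  interpret S: cring S by (rule S_cring)
  obtain a k where s: "s = (a, k)" "a \<in> carrier R" "k \<in> carrier K" using assms by (auto simp: S_simps)
  then have a: "a \<in> Units R" using assms unit_if by auto
  let ?b = "inv a"
  \<comment> \<open>The inverse of (a, k) is (b, - b b k) with b the inverse of a, as the second
    component of the product must vanish.\<close>
  let ?t = "(?b, \<ominus>\<^bsub>K\<^esub> (pr ?b \<otimes>\<^bsub>K\<^esub> (pr ?b \<otimes>\<^bsub>K\<^esub> k)))"
  have b: "?b \<in> carrier R" using a by simp
  have pab: "pr a \<otimes>\<^bsub>K\<^esub> pr ?b = \<one>\<^bsub>K\<^esub>"
    using pr.hom_mult[OF s(2) b] a by simp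
  have "pr a \<otimes>\<^bsub>K\<^esub> (pr ?b \<otimes>\<^bsub>K\<^esub> (pr ?b \<otimes>\<^bsub>K\<^esub> k)) = pr ?b \<otimes>\<^bsub>K\<^esub> k"
    using s b pab K.m_assoc[of "pr a" "pr ?b" "pr ?b \<otimes>\<^bsub>K\<^esub> k"] by simp
  then have "s \<otimes>\<^bsub>S\<^esub> ?t = \<one>\<^bsub>S\<^esub>"
    using s a b by (simp add: S_simps K.r_minus K.l_neg)
  moreover have "?t \<in> carrier S" using b s by (simp add: S_simps)
  ultimately show ?thesis
    using assms(1) S.m_comm[of s ?t] by (auto simp: Units_def)
qed

text \<open>For two elements of m \<times> k both mixed terms of the product vanish, so the square
  of this ideal lies in m \<times> 0. The same vanishing shows that (0, 1) is in the socle, while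
  its second component keeps it outside m \<times> 0.\<close>

lemma S_socle_local_cring:
  "socle_local_cring S (m \<times> carrier K) (m \<times> {\<zero>\<^bsub>K\<^esub>}) (\<zero>, \<one>\<^bsub>K\<^esub>)"
proof -
  have m0: "pr b = \<zero>\<^bsub>K\<^esub>" if "b \<in> m" for b using that pr_eq_zero m.Icarr by simp
  show ?thesis
  proof (intro socle_local_cring.intro local_cring.intro socle_local_cring_axioms.intro local_cring_axioms.intro)
    show "cring S" by (rule S_cring)
    show "ideal (m \<times> carrier K) S" by (rule S_idealI) auto
    show "ideal (m \<times> {\<zero>\<^bsub>K\<^esub>}) S" by (rule S_idealI) auto
    show "\<one>\<^bsub>S\<^esub> \<notin> m \<times> carrier K"
      using m.one_imp_carrier m.I_notcarr by (auto simp: S_simps)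
    show "s \<in> Units S" if "s \<in> carrier S" "s \<notin> m \<times> carrier K" for s using that by (rule S_Units)
    show "s \<otimes>\<^bsub>S\<^esub> t \<in> m \<times> {\<zero>\<^bsub>K\<^esub>}" if "s \<in> m \<times> carrier K" "t \<in> m \<times> carrier K" for s t
      using that m.Icarr by (auto simp: S_simps m0 m.I_l_closed)
    show "(\<zero>, \<one>\<^bsub>K\<^esub>) \<in> m \<times> carrier K" "(\<zero>, \<one>\<^bsub>K\<^esub>) \<notin> m \<times> {\<zero>\<^bsub>K\<^esub>}"
      by auto
    show "s \<otimes>\<^bsub>S\<^esub> (\<zero>, \<one>\<^bsub>K\<^esub>) = \<zero>\<^bsub>S\<^esub>" if "s \<in> m \<times> carrier K" for s
      using that m.Icarr by (auto simp: S_simps m0)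
  qed
qed

section \<open>Noetherianity of R(k)\<close>

definition base_mod :: "('a \<times> 'a set, 'a) module" where
  "base_mod = \<lparr>carrier = carrier R, monoid.mult = undefined, Group.monoid.one = undefined,
     Ring.ring.zero = \<zero>, Ring.ring.add = add R, smult = (\<lambda>s a. fst s \<otimes> a)\<rparr>"

definition res_mod :: "('a \<times> 'a set, 'a set) module" where
  "res_mod = \<lparr>carrier = carrier K, monoid.mult = undefined, Group.monoid.one = undefined,
     Ring.ring.zero = \<zero>\<^bsub>K\<^esub>, Ring.ring.add = add K, smult = (\<lambda>s k. pr (fst s) \<otimes>\<^bsub>K\<^esub> k)\<rparr>"

lemma base_mod_module: "module S base_mod"
proof (rule moduleI)
  show "cring S" by (rule S_cring)
  show "abelian_group base_mod"
    by (rule abelian_groupI) (auto simp: base_mod_def a_ac intro: bexI[of _ "\<ominus> _"] r_neg)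
qed (auto simp: base_mod_def S_simps l_distr r_distr m_assoc)

lemma res_mod_module: "module S res_mod"
proof (rule moduleI)
  show "cring S" by (rule S_cring)
  show "abelian_group res_mod"
    by (rule abelian_groupI) (auto simp: res_mod_def K.a_ac intro: bexI[of _ "\<ominus>\<^bsub>K\<^esub> _"] K.r_neg)
qed (auto simp: res_mod_def S_simps K.l_distr K.r_distr K.m_assoc)

text \<open>The pairs (a, 0) realize every scalar of \<open>R\<close>, so finite generation of
  ideals of \<open>R\<close> can be applied to submodules over R(k).\<close>

lemma base_mod_ideal:
  assumes G: "submodule G S base_mod"
  shows "ideal G R"
proof -
  interpret B: module S base_mod by (rule base_mod_module)
  note GE = B.submoduleE[OF G] B.submodule_zero[OF G]
  have GR: "G \<subseteq> carrier R" using GE(1) by (simp add: base_mod_def)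
  have mult: "a \<otimes> g \<in> G" if "a \<in> carrier R" "g \<in> G" for a g
    using GE(4)[of "(a, \<zero>\<^bsub>K\<^esub>)" g] that by (simp add: base_mod_def S_simps)
  show ?thesis
  proof (rule idealI)
    show "subgroup G (add_monoid R)"
    proof (rule add.subgroupI)
      show "\<ominus> g \<in> G" if "g \<in> G" for g
        using mult[of "\<ominus> \<one>" g] that GR by (auto simp: l_minus subset_iff)
      show "g \<oplus> h \<in> G" if "g \<in> G" "h \<in> G" for g h using GE(5)[OF that] by (simp add: base_mod_def)
    qed (use GE GR in auto)
    show "g \<otimes> a \<in> G" if "g \<in> G" "a \<in> carrier R" for g a
      using mult[OF that(2,1)] m_comm[of a g] that GR by auto
  qed (auto intro: mult ring_axioms)
qed

lemma base_mod_noeth: "noeth S base_mod"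
  unfolding noeth_def fgen_def
proof (intro allI impI)
  interpret B: module S base_mod by (rule base_mod_module)
  fix G assume "submodule G S base_mod"
  then have "ideal G R" by (rule base_mod_ideal)
  then obtain A where A: "A \<subseteq> carrier R" "finite A" "G = Idl A"
    using noetherian_ring.finetely_gen[OF noetherian] by blast
  have AB: "A \<subseteq> carrier base_mod" using A by (simp add: base_mod_def)
  have "ideal (lspan base_mod (carrier S) A) R"
    by (rule base_mod_ideal[OF B.lspan_carrier_submodule[OF AB]])
  moreover have "A \<subseteq> lspan base_mod (carrier S) A" using B.lspan_carrier_base[OF AB] by blast
  ultimately have "G \<subseteq> lspan base_mod (carrier S) A" unfolding A(3) by (rule genideal_minimal)
  then show "\<exists>B. finite B \<and> B \<subseteq> G \<and> G \<subseteq> lspan base_mod (carrier S) B"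
    using A genideal_self[OF A(1)] by blast
qed

lemma res_mod_noeth: "noeth S res_mod"
  unfolding noeth_def fgen_def
proof (intro allI impI)
  interpret B: module S res_mod by (rule res_mod_module)
  fix G assume G: "submodule G S res_mod"
  have GK: "G \<subseteq> carrier K" using B.submoduleE(1)[OF G] by (simp add: res_mod_def)
  show "\<exists>B. finite B \<and> B \<subseteq> G \<and> G \<subseteq> lspan res_mod (carrier S) B"
  proof (cases "G \<subseteq> {\<zero>\<^bsub>K\<^esub>}")
    case True
    then show ?thesis
      using lspan.lspan_zero[of res_mod] by (intro exI[of _ "{}"]) (auto simp: res_mod_def)
  next
    case False
    then obtain k where k: "k \<in> G" "k \<noteq> \<zero>\<^bsub>K\<^esub>" by blast
    then have ku: "k \<in> Units K" using GK K.field_Units by auto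
    have kB: "{k} \<subseteq> carrier res_mod" using k GK by (auto simp: res_mod_def)
    have "g \<in> lspan res_mod (carrier S) {k}" if "g \<in> G" for g
    proof -
      have g: "g \<in> carrier K" using that GK by auto
      obtain a where a: "a \<in> carrier R" "g \<otimes>\<^bsub>K\<^esub> inv\<^bsub>K\<^esub> k = pr a"
        using pr_surj[of "g \<otimes>\<^bsub>K\<^esub> inv\<^bsub>K\<^esub> k"] g ku by auto
      have "g = pr a \<otimes>\<^bsub>K\<^esub> k"
        using g ku K.Units_closed[OF ku] by (simp add: a(2)[symmetric] K.m_assoc)
      also have "\<dots> = (a, \<zero>\<^bsub>K\<^esub>) \<odot>\<^bsub>res_mod\<^esub> k" by (simp add: res_mod_def)
      finally show ?thesis
        using B.lspan_base[OF subset_refl kB, of "(a, \<zero>\<^bsub>K\<^esub>)" k] a by (simp add: S_simps)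
    qed
    then show ?thesis using k by (intro exI[of _ "{k}"]) auto
  qed
qed

text \<open>Projection to the first component and inclusion of the second give an exact sequence 0,
  k, R(k), R, 0 of modules over R(k). The outer terms are Noetherian: one has the ideals of
  \<open>R\<close> as submodules, the other is a line over a field.\<close>

lemma S_noeth: "noeth S (smod S)"
proof (rule noeth_exact)
  interpret S: cring S by (rule S_cring)
  show "linear_map S (smod S) base_mod fst"
    by (intro linear_mapI S.smod_module base_mod_module) (auto simp: lin_def smod_def base_mod_def S_simps)
  show "linear_map S res_mod (smod S) (\<lambda>k. (\<zero>, k))"
    by (intro linear_mapI S.smod_module res_mod_module) (auto simp: lin_def smod_def res_mod_def S_simps)
  show "s \<in> (\<lambda>k. (\<zero>, k)) ` carrier res_mod" if "s \<in> carrier (smod S)" "fst s = \<zero>\<^bsub>base_mod\<^esub>" for s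
    using that by (auto simp: smod_def base_mod_def res_mod_def S_simps)
qed (rule res_mod_noeth base_mod_noeth)+

end

text \<open>A nonunit generates a proper principal ideal. This lies in some maximal ideal, which
  locality identifies with \<open>max_ideal R\<close>; so elements outside that ideal are
  units.\<close>

lemma residue_extI:
  fixes R (structure)
  assumes noeth: "noetherian_ring R" and "local_ring R"
  shows "residue_ext R (max_ideal R)"
proof -
  interpret cring R using noeth by (simp add: Defs.noetherian_ring_def)
  have N: "Ring_Divisibility.noetherian_ring R"
  proof (rule noetherian_ring.intro[OF ring_axioms noetherian_ring_axioms.intro])
    show "\<exists>A\<subseteq>carrier R. finite A \<and> I = Idl A" if "ideal I R" for I
      using noeth that by (auto simp: Defs.noetherian_ring_def)
  qed
  have ex1: "\<exists>!J. maximalideal J R" using assms(2) by (simp add: local_ring_def)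
  have max: "maximalideal (max_ideal R) R" unfolding max_ideal_def using ex1 by (rule theI')
  have "a \<in> Units R" if a: "a \<in> carrier R" "a \<notin> max_ideal R" for a
  proof (rule ccontr)
    assume nu: "a \<notin> Units R"
    have "\<one> \<notin> PIdl a"
    proof
      assume "\<one> \<in> PIdl a"
      then obtain b where "b \<in> carrier R" "\<one> = b \<otimes> a" by (auto simp: cgenideal_def)
      then show False using nu a(1) m_comm[of b a] by (auto simp: Units_def)
    qed
    then have "PIdl a \<noteq> carrier R" by auto
    then obtain J where J: "maximalideal J R" "PIdl a \<subseteq> J"
      using exists_maximalideal[OF N cgenideal_ideal[OF a(1)]] by blast
    then have "J = max_ideal R" using ex1 max by blast
    then show False using J(2) cgenideal_self[OF a(1)] a(2) by blast
  qed
  then show ?thesis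
    by (intro residue_ext.intro residue_ext_axioms.intro is_cring max N)
qed

theorem theorem3p1:
  fixes R :: "('a, 'b) ring_scheme"
    and M :: "('a \<times> 'a set, 'c) module"
    and N :: "('a \<times> 'a set, 'd) module"
  defines "S \<equiv> triv_ext R (residue_module R (max_ideal R))"
  assumes "noetherian_ring R" and "local_ring R"
    and "module S M" and "fin_gen S M" and "carrier M \<noteq> {\<zero>\<^bsub>M\<^esub>}" and "\<not> free_module S M"
    and "module S N" and "fin_gen S N" and "carrier N \<noteq> {\<zero>\<^bsub>N\<^esub>}" and "\<not> free_module S N"
    and "n \<ge> 3"
  shows "\<not> Tor_zero S M N n"
proof -
  interpret residue_ext R "max_ideal R" using assms(2,3) by (rule residue_extI)
  show ?thesis
    using assms(4,5,7,8,9,11,12) unfolding S_def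
    by (rule socle_local_cring.tor_nonzero[OF S_socle_local_cring S_noeth])
qed

end
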